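(* Let $g_{EH}$ be the Eguchi-Hanson metric on the blow-up $\tilde{\mathbb{C}}^2$ of $\mathbb{C}^2$ at the origin, with associated form $\omega_{EH}$. Then for every positive integer $m$, the metric $m g_{EH}$ is not balanced; that is, for every positive integer $m$ the function $\epsilon_{m g_{EH}}$ on $\tilde{\mathbb{C}}^2$ is not a positive constant.
   Context: **Blow-up.** $\tilde{\mathbb{C}}^2=\{(z_1,z_2,[t_1,t_2])\in\mathbb{C}^2\times\mathbb{C}P^1 : t_1z_2-t_2z_1=0\}$, a closed complex submanifold of $\mathbb{C}^2\times\mathbb{C}P^1$ of complex dimension $2$. The exceptional divisor is $H=\{(z,[t])\in\tilde{\mathbb{C}}^2 : z=0\}\simeq\mathbb{C}P^1$, and the map $p_r:\tilde{\mathbb{C}}^2\setminus H\to\mathbb{C}^2\setminus\{0\}$, $(z,[t])\mapsto z$, is a biholomorphism. $\tilde{\mathbb{C}}^2$ is covered by two charts with parametrizations $\mathbb{C}^2\ni(w_1,w_2)\mapsto(w_1,w_1w_2,[1,w_2])$ and $\mathbb{C}^2\ni(w_1,w_2)\mapsto(w_1w_2,w_2,[w_1,1])$. **Eguchi-Hanson metric.** On $\mathbb{C}^2\setminus\{0\}$, with $|z|^2=|z_1|^2+|z_2|^2$, let $$\omega=\frac{i}{2\pi}\partial\bar\partial\left(\sqrt{|z|^4+1}+\log|z|^2-\log\left(1+\sqrt{|z|^4+1}\right)\right).$$ The pull-back $p_r^*\omega$ extends smoothly to a closed real $(1,1)$-form $\omega_{EH}$ on all of $\tilde{\mathbb{C}}^2$.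 In the first chart it is $$\frac{i}{2\pi}\partial\bar\partial\left(\sqrt{|w_1|^4(1+|w_2|^2)^2+1}+\log\frac{1+|w_2|^2}{1+\sqrt{|w_1|^4(1+|w_2|^2)^2+1}}\right),$$ and in the second chart it is given by the same expression with $w_1$ and $w_2$ interchanged. The Eguchi-Hanson metric $g_{EH}$ is the metric associated to $\omega_{EH}$, and $m g_{EH}$ has associated form $m\omega_{EH}$. **Balanced condition.** The form $\omega_{EH}$ is integral. Let $L\to\tilde{\mathbb{C}}^2$ be the holomorphic line bundle (unique up to isomorphism) with $c_1(L)=[\omega_{EH}]_{dR}$. For a positive integer $m$, let $L^m$ be the $m$-th tensor power of $L$ and let $h_m$ be a Hermitian metric on $L^m$ with $\mathrm{Ric}(h_m)=m\omega_{EH}$. Here $\mathrm{Ric}(h_m)$ is the two-form with local expression $-\frac{i}{2\pi}\partial\bar\partial\log h_m(\sigma(x),\sigma(x))$ for a trivializing (nowhere vanishing) local holomorphic section $\sigma:U\to L^m\setminus\{0\}$. Let $\mathcal{H}_m$ be the separable complex Hilbert space of global holomorphic sections $s$ of $L^m$ with $$\langle s,s\rangle_{h_m}=\|s\|_{h_m}^2=\int_{\tilde{\mathbb{C}}^2}h_m(s(x),s(x))\,\frac{\omega_{EH}^2}{2!}<\infty,$$ let $\{s_j\}_{j=0,\dots,d_m}$ (with $\dim\mathcal{H}_m=d_m+1\le\infty$) be an orthonormal basis of $(\mathcal{H}_m,\langle\cdot,\cdot\rangle_{h_m})$, and define $$\epsilon_{m g_{EH}}(x)=\sum_{j=0}^{d_m}h_m(s_j(x),s_j(x)),\qquad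 x\in\tilde{\mathbb{C}}^2.$$ This function does not depend on the choice of orthonormal basis or of the Hermitian metric $h_m$. The metric $m g_{EH}$ is called balanced if $\epsilon_{m g_{EH}}$ is a positive constant function on $\tilde{\mathbb{C}}^2$. *)

theory Defs
  imports "HOL-Analysis.Analysis" "HOL-Library.Extended_Nat"
begin

section \<open>The blow-up of the plane at the origin\<close>

definition proj_rel :: "complex \<times> complex \<Rightarrow> complex \<times> complex \<Rightarrow> bool" where
  "proj_rel s t \<longleftrightarrow>
     s \<noteq> 0 \<and> t \<noteq> 0 \<and> (\<exists>c. c \<noteq> 0 \<and> t = (c * fst s, c * snd s))"

lemma proj_rel_sym:
  assumes "proj_rel s t"
  shows "proj_rel t s"
proof -
  obtain c where c: "s \<noteq> 0" "t \<noteq> 0" "c \<noteq> 0" "t = (c * fst s, c * snd s)"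
    using assms by (auto simp: proj_rel_def)
  then have "s = (inverse c * fst t, inverse c * snd t)" by (simp add: prod_eq_iff)
  then show ?thesis
    unfolding proj_rel_def using c(1-3) by (intro conjI exI[of _ "inverse c"]) auto
qed

lemma proj_rel_trans:
  assumes "proj_rel s t" "proj_rel t u"
  shows "proj_rel s u"
proof -
  obtain c d where c: "s \<noteq> 0" "u \<noteq> 0" "c \<noteq> 0" "d \<noteq> 0"
    "t = (c * fst s, c * snd s)" "u = (d * fst t, d * snd t)"
    using assms by (auto simp: proj_rel_def)
  then show ?thesis
    unfolding proj_rel_def by (intro conjI exI[of _ "d * c"]) auto
qed

quotient_type cp1 = "complex \<times> complex" / partial: proj_rel
proof (rule part_equivpI)
  show "\<exists>x. proj_rel x x"
    by (intro exI[of _ "(1, 0)"]) (auto simp: proj_rel_def zero_prod_def intro: exI[of _ 1])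
  show "symp proj_rel" by (auto intro!: sympI proj_rel_sym)
  show "transp proj_rel" by (auto intro!: transpI elim: proj_rel_trans)
qed

text \<open>\<open>abs_cp1 (t1, t2)\<close> is the point $[t_1, t_2]$, for $(t_1,t_2) \neq 0$.\<close>

lemma abs_cp1_eq_iff:
  "s \<noteq> 0 \<Longrightarrow> t \<noteq> 0 \<Longrightarrow> abs_cp1 s = abs_cp1 t \<longleftrightarrow> proj_rel s t"
  using Quotient3_rel_abs[OF Quotient3_cp1] Quotient3_rel[OF Quotient3_cp1, of s t]
  by (auto simp: proj_rel_def intro: exI[of _ 1])

typedef blowup =
  "{(z1, z2, abs_cp1 (t1, t2)) | z1 z2 t1 t2. (t1, t2) \<noteq> (0, 0) \<and> t1 * z2 - t2 * z1 = 0}"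
  by (intro exI[of _ "(0, 0, abs_cp1 (1, 0))"]) force

datatype chart = Chart1 | Chart2

fun param :: "chart \<Rightarrow> complex \<times> complex \<Rightarrow> blowup" where
  "param Chart1 (w1, w2) = Abs_blowup (w1, w1 * w2, abs_cp1 (1, w2))"
| "param Chart2 (w1, w2) = Abs_blowup (w1 * w2, w2, abs_cp1 (w1, 1))"

text \<open>The map $p_r$, on all of the blow-up; the exceptional divisor is its zero set.\<close>

definition blow_down :: "blowup \<Rightarrow> complex \<times> complex" where
  "blow_down x = (case Rep_blowup x of (z1, z2, p) \<Rightarrow> (z1, z2))"

lemma Rep_param:
  "Rep_blowup (param Chart1 (w1, w2)) = (w1, w1 * w2, abs_cp1 (1, w2))"
  "Rep_blowup (param Chart2 (w1, w2)) = (w1 * w2, w2, abs_cp1 (w1, 1))"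
proof -
  have "(w1, w1 * w2, abs_cp1 (1, w2)) \<in> {(z1, z2, abs_cp1 (t1, t2)) | z1 z2 t1 t2.
      (t1, t2) \<noteq> (0, 0) \<and> t1 * z2 - t2 * z1 = 0}"
    by (simp, intro exI[of _ 1] exI[of _ w2]) auto
  then show "Rep_blowup (param Chart1 (w1, w2)) = (w1, w1 * w2, abs_cp1 (1, w2))"
    by (simp add: Abs_blowup_inverse)
  have "(w1 * w2, w2, abs_cp1 (w1, 1)) \<in> {(z1, z2, abs_cp1 (t1, t2)) | z1 z2 t1 t2.
      (t1, t2) \<noteq> (0, 0) \<and> t1 * z2 - t2 * z1 = 0}"
    by (simp, intro exI[of _ w1] exI[of _ 1]) auto
  then show "Rep_blowup (param Chart2 (w1, w2)) = (w1 * w2, w2, abs_cp1 (w1, 1))"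
    by (simp add: Abs_blowup_inverse)
qed

lemma inj_param: "inj (param k)"
proof (rule injI)
  fix v w :: "complex \<times> complex"
  assume eq: "param k v = param k w"
  obtain v1 v2 w1 w2 where vw: "v = (v1, v2)" "w = (w1, w2)" by (metis surj_pair)
  show "v = w"
  proof (cases k)
    case Chart1
    then have "Rep_blowup (param Chart1 (v1, v2)) = Rep_blowup (param Chart1 (w1, w2))"
      using eq vw by simp
    then show ?thesis
      unfolding Rep_param vw by (auto simp: abs_cp1_eq_iff proj_rel_def zero_prod_def)
  next
    case Chart2
    then have "Rep_blowup (param Chart2 (v1, v2)) = Rep_blowup (param Chart2 (w1, w2))"
      using eq vw by simp
    then show ?thesis
      unfolding Rep_param vw by (auto simp: abs_cp1_eq_iff proj_rel_def zero_prod_def)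
  qed
qed

lemma param_cover: "range (param Chart1) \<union> range (param Chart2) = UNIV"
proof -
  have "x \<in> range (param Chart1) \<union> range (param Chart2)" for x
  proof -
    obtain z1 z2 t1 t2 where x: "Rep_blowup x = (z1, z2, abs_cp1 (t1, t2))"
      and t: "(t1, t2) \<noteq> (0, 0)" and z: "t1 * z2 - t2 * z1 = 0"
      using Rep_blowup[of x] by auto
    show ?thesis
    proof (cases "t1 = 0")
      case True
      then have t2: "t2 \<noteq> 0" "z1 = 0" using t z by auto
      have "abs_cp1 (t1, t2) = abs_cp1 (0, 1)"
        using t2 True by (subst abs_cp1_eq_iff)
          (auto simp: proj_rel_def zero_prod_def intro: exI[of _ "1 / t2"])
      then have "x = param Chart2 (0, z2)"
        using x t2 Rep_param(2)[of 0 z2]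
        by (simp add: Rep_blowup_inject[symmetric] del: param.simps)
      then show ?thesis by blast
    next
      case False
      have "abs_cp1 (t1, t2) = abs_cp1 (1, t2 / t1)"
        using False by (subst abs_cp1_eq_iff)
          (auto simp: proj_rel_def zero_prod_def intro: exI[of _ "1 / t1"])
      moreover have "z2 = z1 * (t2 / t1)" using False z by (simp add: field_simps)
      ultimately have "x = param Chart1 (z1, t2 / t1)"
        using x Rep_param(1)[of z1 "t2 / t1"]
        by (simp add: Rep_blowup_inject[symmetric] del: param.simps)
      then show ?thesis by blast
    qed
  qed
  then show ?thesis by blast
qed

text \<open>
  The manifold topology, for which the two charts are homeomorphisms onto open sets.
  It is the topology induced from the product of the plane and the projective line.
\<close>

instantiation blowup :: topological_space
begin

definition open_blowup :: "blowup set \<Rightarrow> bool" where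
  "open_blowup V \<longleftrightarrow> (\<forall>k. open (param k -` V))"

instance
  by standard (auto simp: open_blowup_def vimage_Union)

end


section \<open>Smooth and holomorphic functions\<close>

text \<open>These two notions are meant for open sets \<open>S\<close>.\<close>

primrec Ck_on :: "nat \<Rightarrow> ('a::real_normed_vector \<Rightarrow> 'b::real_normed_vector) \<Rightarrow> 'a set \<Rightarrow> bool" where
  "Ck_on 0 f S \<longleftrightarrow> continuous_on S f"
| "Ck_on (Suc n) f S \<longleftrightarrow>
     (\<forall>x\<in>S. f differentiable (at x)) \<and>
     (\<forall>v. Ck_on n (\<lambda>x. frechet_derivative f (at x) v) S)"

definition smooth_on :: "('a::real_normed_vector \<Rightarrow> 'b::real_normed_vector) \<Rightarrow> 'a set \<Rightarrow> bool" where
  "smooth_on f S \<longleftrightarrow> (\<forall>n. Ck_on n f S)"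

definition holomorphic2_on :: "(complex \<times> complex \<Rightarrow> complex) \<Rightarrow> (complex \<times> complex) set \<Rightarrow> bool" where
  "holomorphic2_on f S \<longleftrightarrow>
     (\<forall>w\<in>S. \<exists>a b. (f has_derivative (\<lambda>(u, v). a * u + b * v)) (at w))"

definition bl_smooth_on :: "(blowup \<Rightarrow> complex) \<Rightarrow> blowup set \<Rightarrow> bool" where
  "bl_smooth_on f V \<longleftrightarrow> (\<forall>k. smooth_on (f \<circ> param k) (param k -` V))"

definition bl_holomorphic_on :: "(blowup \<Rightarrow> complex) \<Rightarrow> blowup set \<Rightarrow> bool" where
  "bl_holomorphic_on f V \<longleftrightarrow> (\<forall>k. holomorphic2_on (f \<circ> param k) (param k -` V))"


section \<open>Differential forms\<close>

text \<open>
  A (complex-valued) form on the blow-up is given by its two coordinate expressions: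
  \<open>\<alpha> k w v\<close> is the value at the point \<open>w\<close> of chart \<open>k\<close> on the
  coordinate tangent vector \<open>v\<close>, and similarly \<open>\<eta> k w a b\<close> for two-forms.
\<close>

type_synonym form1 = "chart \<Rightarrow> complex \<times> complex \<Rightarrow> complex \<times> complex \<Rightarrow> complex"
type_synonym form2 =
  "chart \<Rightarrow> complex \<times> complex \<Rightarrow> complex \<times> complex \<Rightarrow> complex \<times> complex \<Rightarrow> complex"

definition transition :: "chart \<Rightarrow> chart \<Rightarrow> complex \<times> complex \<Rightarrow> complex \<times> complex" where
  "transition k l w = inv (param l) (param k w)"

definition smooth_form1 :: "form1 \<Rightarrow> bool" where
  "smooth_form1 \<alpha> \<longleftrightarrow>
     (\<forall>k w. linear (\<alpha> k w)) \<and>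
     (\<forall>k v. smooth_on (\<lambda>w. \<alpha> k w v) UNIV) \<and>
     (\<forall>k l w v. param k w \<in> range (param l) \<longrightarrow>
        \<alpha> k w v = \<alpha> l (transition k l w) (frechet_derivative (transition k l) (at w) v))"

definition ext_d :: "form1 \<Rightarrow> form2" where
  "ext_d \<alpha> k w a b =
     frechet_derivative (\<lambda>y. \<alpha> k y b) (at w) a - frechet_derivative (\<lambda>y. \<alpha> k y a) (at w) b"

text \<open>The de Rham class of a closed two-form, as a set of two-forms.\<close>

definition dR_class :: "form2 \<Rightarrow> form2 set" where
  "dR_class \<eta> = {\<theta>. \<exists>\<alpha>. smooth_form1 \<alpha> \<and> \<theta> = (\<lambda>k w a b. \<eta> k w a b + ext_d \<alpha> k w a b)}"

definition times_i :: "complex \<times> complex \<Rightarrow> complex \<times> complex" where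
  "times_i v = (\<i> * fst v, \<i> * snd v)"

text \<open>
  The complex linear and antilinear parts of the differential, that is
  $\partial f(v) = \sum_j \frac{\partial f}{\partial w_j} v_j$ and
  $\bar\partial f(v) = \sum_j \frac{\partial f}{\partial \bar w_j} \bar v_j$.
\<close>

definition dee :: "(complex \<times> complex \<Rightarrow> complex) \<Rightarrow> complex \<times> complex \<Rightarrow> complex \<times> complex \<Rightarrow> complex" where
  "dee f w v =
     (frechet_derivative f (at w) v - \<i> * frechet_derivative f (at w) (times_i v)) / 2"

definition dee_bar :: "(complex \<times> complex \<Rightarrow> complex) \<Rightarrow> complex \<times> complex \<Rightarrow> complex \<times> complex \<Rightarrow> complex" where
  "dee_bar f w v =
     (frechet_derivative f (at w) v + \<i> * frechet_derivative f (at w) (times_i v)) / 2"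

text \<open>
  $\partial\bar\partial f = \sum_{j,k} \frac{\partial^2 f}{\partial w_j \partial\bar w_k}
  dw_j \wedge d\bar w_k$, with the convention
  $(\alpha\wedge\beta)(a,b) = \alpha(a)\beta(b) - \alpha(b)\beta(a)$.
\<close>

definition dee_dee_bar ::
  "(complex \<times> complex \<Rightarrow> complex) \<Rightarrow> complex \<times> complex \<Rightarrow> complex \<times> complex \<Rightarrow> complex \<times> complex \<Rightarrow> complex" where
  "dee_dee_bar f w a b =
     dee (\<lambda>y. dee_bar f y b) w a - dee (\<lambda>y. dee_bar f y a) w b"

definition wedge ::
  "('a \<Rightarrow> 'a \<Rightarrow> complex) \<Rightarrow> ('a \<Rightarrow> 'a \<Rightarrow> complex) \<Rightarrow> 'a \<Rightarrow> 'a \<Rightarrow> 'a \<Rightarrow> 'a \<Rightarrow> complex" where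
  "wedge \<eta> \<theta> a b c d =
     \<eta> a b * \<theta> c d - \<eta> a c * \<theta> b d + \<eta> a d * \<theta> b c
     + \<eta> b c * \<theta> a d - \<eta> b d * \<theta> a c + \<eta> c d * \<theta> a b"


section \<open>The Eguchi-Hanson form and its volume\<close>

fun EH_pot :: "chart \<Rightarrow> complex \<times> complex \<Rightarrow> real" where
  "EH_pot Chart1 (w1, w2) =
     sqrt (cmod w1 ^ 4 * (1 + (cmod w2)\<^sup>2)\<^sup>2 + 1)
     + ln ((1 + (cmod w2)\<^sup>2) / (1 + sqrt (cmod w1 ^ 4 * (1 + (cmod w2)\<^sup>2)\<^sup>2 + 1)))"
| "EH_pot Chart2 (w1, w2) =
     sqrt (cmod w2 ^ 4 * (1 + (cmod w1)\<^sup>2)\<^sup>2 + 1)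
     + ln ((1 + (cmod w1)\<^sup>2) / (1 + sqrt (cmod w2 ^ 4 * (1 + (cmod w1)\<^sup>2)\<^sup>2 + 1)))"

definition omega_EH :: form2 where
  "omega_EH k w a b =
     \<i> / (2 * of_real pi) * dee_dee_bar (\<lambda>y. complex_of_real (EH_pot k y)) w a b"

text \<open>
  Off the exceptional divisor the chart potentials differ from the pull-back of the
  potential on the punctured plane only by a pluriharmonic function, so \<open>omega_EH\<close>
  extends the pull-back of the form given there.
\<close>

definition plane_pot :: "complex \<times> complex \<Rightarrow> real" where
  "plane_pot z = sqrt (norm z ^ 4 + 1) + ln ((norm z)\<^sup>2) - ln (1 + sqrt (norm z ^ 4 + 1))"

lemma EH_pot_eq_plane_pot:
  "w1 \<noteq> 0 \<Longrightarrow>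
     EH_pot Chart1 (w1, w2) = plane_pot (blow_down (param Chart1 (w1, w2))) - ln ((cmod w1)\<^sup>2)"
  "w2 \<noteq> 0 \<Longrightarrow>
     EH_pot Chart2 (w1, w2) = plane_pot (blow_down (param Chart2 (w1, w2))) - ln ((cmod w2)\<^sup>2)"
proof -
  have *: "sqrt (cmod s ^ 4 * (1 + (cmod t)\<^sup>2)\<^sup>2 + 1)
     + ln ((1 + (cmod t)\<^sup>2) / (1 + sqrt (cmod s ^ 4 * (1 + (cmod t)\<^sup>2)\<^sup>2 + 1)))
     = plane_pot z - ln ((cmod s)\<^sup>2)"
    if s: "s \<noteq> 0" and z: "(norm z)\<^sup>2 = (cmod s)\<^sup>2 * (1 + (cmod t)\<^sup>2)" for s t z
  proof -
    have 4: "norm z ^ 4 = cmod s ^ 4 * (1 + (cmod t)\<^sup>2)\<^sup>2"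
    proof -
      have "norm z ^ 4 = ((norm z)\<^sup>2)\<^sup>2" by (simp flip: power_mult)
      also have "\<dots> = cmod s ^ 4 * (1 + (cmod t)\<^sup>2)\<^sup>2"
        by (simp add: z power_mult_distrib flip: power_mult)
      finally show ?thesis .
    qed
    have p: "1 + (cmod t)\<^sup>2 > 0" "(cmod s)\<^sup>2 > 0"
      using s by (auto simp: add_pos_nonneg)
    have q: "1 + sqrt (cmod s ^ 4 * (1 + (cmod t)\<^sup>2)\<^sup>2 + 1) > 0"
      by (intro add_pos_nonneg) auto
    show ?thesis
      unfolding plane_pot_def 4 z using p q s by (simp add: ln_div ln_mult)
  qed
  show "EH_pot Chart1 (w1, w2) = plane_pot (blow_down (param Chart1 (w1, w2))) - ln ((cmod w1)\<^sup>2)"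
    if "w1 \<noteq> 0"
    unfolding EH_pot.simps blow_down_def Rep_param
    by (rule *[OF that]) (simp add: norm_Pair norm_mult power_mult_distrib algebra_simps)
  show "EH_pot Chart2 (w1, w2) = plane_pot (blow_down (param Chart2 (w1, w2))) - ln ((cmod w2)\<^sup>2)"
    if "w2 \<noteq> 0"
    unfolding EH_pot.simps blow_down_def Rep_param
    by (rule *[OF that]) (simp add: norm_Pair norm_mult power_mult_distrib algebra_simps)
qed

text \<open>
  The density of $\omega_{EH}^2/2!$ with respect to Lebesgue measure in a chart:
  its value on the oriented orthonormal basis $e_1, i e_1, e_2, i e_2$.
\<close>

definition EH_density :: "chart \<Rightarrow> complex \<times> complex \<Rightarrow> real" where
  "EH_density k w =
     Re (wedge (omega_EH k w) (omega_EH k w) (1, 0) (\<i>, 0) (0, 1) (0, \<i>)) / 2"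

text \<open>
  The measure of integration against $\omega_{EH}^2/2!$, computed in the first chart
  on the range of that chart and in the second chart on the rest.
\<close>

definition EH_volume :: "blowup measure" where
  "EH_volume = measure_of UNIV (sets borel) (\<lambda>A.
     (\<integral>\<^sup>+ w. ennreal (EH_density Chart1 w) * indicator (param Chart1 -` A) w \<partial>lborel) +
     (\<integral>\<^sup>+ w. ennreal (EH_density Chart2 w) *
              indicator (param Chart2 -` (A - range (param Chart1))) w \<partial>lborel))"


section \<open>Holomorphic line bundles\<close>

text \<open>
  A holomorphic line bundle is given by an open cover with holomorphic transition
  functions. A point of the fibre over \<open>x\<close> is the family of its coordinates in the
  trivializations around \<open>x\<close>; the coordinates belonging to members of the cover that
  do not contain \<open>x\<close> are set to \<open>0\<close>.
\<close>

record 'i line_bundle =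
  nbh :: "'i \<Rightarrow> blowup set"
  trans_fun :: "'i \<Rightarrow> 'i \<Rightarrow> blowup \<Rightarrow> complex"

definition holomorphic_line_bundle :: "'i line_bundle \<Rightarrow> bool" where
  "holomorphic_line_bundle L \<longleftrightarrow>
     (\<forall>i. open (nbh L i)) \<and> (\<Union>i. nbh L i) = UNIV \<and>
     (\<forall>i j. bl_holomorphic_on (trans_fun L i j) (nbh L i \<inter> nbh L j)) \<and>
     (\<forall>i j. \<forall>x \<in> nbh L i \<inter> nbh L j. trans_fun L i j x \<noteq> 0) \<and>
     (\<forall>i. \<forall>x \<in> nbh L i. trans_fun L i i x = 1) \<and>
     (\<forall>i j k. \<forall>x \<in> nbh L i \<inter> nbh L j \<inter> nbh L k.
        trans_fun L i j x * trans_fun L j k x = trans_fun L i k x)"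

definition fibre :: "'i line_bundle \<Rightarrow> blowup \<Rightarrow> ('i \<Rightarrow> complex) set" where
  "fibre L x = {v. (\<forall>i. x \<notin> nbh L i \<longrightarrow> v i = 0) \<and>
     (\<forall>i j. x \<in> nbh L i \<inter> nbh L j \<longrightarrow> v i = trans_fun L i j x * v j)}"

definition tensor_power :: "'i line_bundle \<Rightarrow> nat \<Rightarrow> 'i line_bundle" where
  "tensor_power L m = L\<lparr>trans_fun := (\<lambda>i j x. trans_fun L i j x ^ m)\<rparr>"

definition holomorphic_section ::
  "'i line_bundle \<Rightarrow> blowup set \<Rightarrow> (blowup \<Rightarrow> 'i \<Rightarrow> complex) \<Rightarrow> bool" where
  "holomorphic_section L V s \<longleftrightarrow>
     (\<forall>x\<in>V. s x \<in> fibre L x) \<and> (\<forall>i. bl_holomorphic_on (\<lambda>x. s x i) (V \<inter> nbh L i))"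

definition trivializing_section ::
  "'i line_bundle \<Rightarrow> blowup set \<Rightarrow> (blowup \<Rightarrow> 'i \<Rightarrow> complex) \<Rightarrow> bool" where
  "trivializing_section L V s \<longleftrightarrow>
     holomorphic_section L V s \<and> (\<forall>x\<in>V. s x \<noteq> (\<lambda>i. 0))"

type_synonym 'i fibre_form = "blowup \<Rightarrow> ('i \<Rightarrow> complex) \<Rightarrow> ('i \<Rightarrow> complex) \<Rightarrow> complex"

definition hermitian_metric :: "'i line_bundle \<Rightarrow> 'i fibre_form \<Rightarrow> bool" where
  "hermitian_metric L h \<longleftrightarrow>
     (\<forall>x. \<forall>u \<in> fibre L x. \<forall>v \<in> fibre L x. \<forall>w \<in> fibre L x. \<forall>c.
        h x (\<lambda>i. u i + c * v i) w = h x u w + c * h x v w) \<and>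
     (\<forall>x. \<forall>u \<in> fibre L x. \<forall>v \<in> fibre L x. h x v u = cnj (h x u v)) \<and>
     (\<forall>x. \<forall>u \<in> fibre L x. u \<noteq> (\<lambda>i. 0) \<longrightarrow> Re (h x u u) > 0) \<and>
     (\<forall>V s t. open V \<and> holomorphic_section L V s \<and> holomorphic_section L V t \<longrightarrow>
        bl_smooth_on (\<lambda>x. h x (s x) (t x)) V)"

text \<open>\<open>has_Ric L h \<eta>\<close> says that the two-form $\mathrm{Ric}(h)$ is \<open>\<eta>\<close>.\<close>

definition has_Ric :: "'i line_bundle \<Rightarrow> 'i fibre_form \<Rightarrow> form2 \<Rightarrow> bool" where
  "has_Ric L h \<eta> \<longleftrightarrow>
     (\<forall>V s. open V \<and> trivializing_section L V s \<longrightarrow>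
        (\<forall>k w a b. param k w \<in> V \<longrightarrow>
           \<eta> k w a b = - (\<i> / (2 * of_real pi)) *
             dee_dee_bar (\<lambda>y. complex_of_real
               (ln (Re (h (param k y) (s (param k y)) (s (param k y)))))) w a b))"

text \<open>
  The first Chern class in de Rham cohomology, by Chern-Weil theory: the class of
  $\mathrm{Ric}(h)$, which is the same for every Hermitian metric \<open>h\<close>.
\<close>

definition c1 :: "'i line_bundle \<Rightarrow> form2 set" where
  "c1 L = \<Union> {dR_class \<eta> | h \<eta>. hermitian_metric L h \<and> has_Ric L h \<eta>}"


section \<open>The balanced condition\<close>

definition H_space ::
  "'i line_bundle \<Rightarrow> 'i fibre_form \<Rightarrow> (blowup \<Rightarrow> 'i \<Rightarrow> complex) set" where
  "H_space L h = {s. holomorphic_section L UNIV s \<and>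
     (\<integral>\<^sup>+ x. ennreal (Re (h x (s x) (s x))) \<partial>EH_volume) < \<infinity>}"

definition H_inner ::
  "'i fibre_form \<Rightarrow> (blowup \<Rightarrow> 'i \<Rightarrow> complex) \<Rightarrow> (blowup \<Rightarrow> 'i \<Rightarrow> complex) \<Rightarrow> complex" where
  "H_inner h s t = (LINT x|EH_volume. h x (s x) (t x))"

text \<open>An orthonormal basis with \<open>N \<le> \<infinity>\<close> elements: an orthonormal system with dense span.\<close>

definition orthonormal_basis ::
  "'i line_bundle \<Rightarrow> 'i fibre_form \<Rightarrow> enat \<Rightarrow> (nat \<Rightarrow> blowup \<Rightarrow> 'i \<Rightarrow> complex) \<Rightarrow> bool" where
  "orthonormal_basis L h N s \<longleftrightarrow>
     (\<forall>j. enat j < N \<longrightarrow> s j \<in> H_space L h) \<and>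
     (\<forall>j l. enat j < N \<and> enat l < N \<longrightarrow> H_inner h (s j) (s l) = (if j = l then 1 else 0)) \<and>
     (\<forall>t \<in> H_space L h. \<forall>e>0. \<exists>n c. enat n \<le> N \<and>
        (let r = (\<lambda>x i. t x i - (\<Sum>j<n. c j * s j x i)) in sqrt (Re (H_inner h r r)) < e))"

definition epsilon_fun ::
  "'i fibre_form \<Rightarrow> enat \<Rightarrow> (nat \<Rightarrow> blowup \<Rightarrow> 'i \<Rightarrow> complex) \<Rightarrow> blowup \<Rightarrow> real" where
  "epsilon_fun h N s x = (\<Sum>\<^sub>\<infinity>j\<in>{j. enat j < N}. Re (h x (s j x) (s j x)))"

text \<open>
  The metric $m g_{EH}$, whose associated form is \<open>m\<close> times \<open>omega_EH\<close>, is balanced,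
  where \<open>L\<close> is the quantizing line bundle. The function \<open>epsilon_fun\<close> does not depend on
  the Hermitian metric \<open>h\<close> nor on the orthonormal basis \<open>s\<close>.
\<close>

definition EH_balanced :: "'i line_bundle \<Rightarrow> nat \<Rightarrow> bool" where
  "EH_balanced L m \<longleftrightarrow>
     (\<exists>h N s. hermitian_metric (tensor_power L m) h \<and>
        has_Ric (tensor_power L m) h (\<lambda>k w a b. of_nat m * omega_EH k w a b) \<and>
        orthonormal_basis (tensor_power L m) h N s \<and>
        (\<exists>c>0. \<forall>x. epsilon_fun h N s x = c))"

end

theory Submission
  imports Defs "HOL-Complex_Analysis.Complex_Analysis"
begin

text \<open>
  The obstruction sits at a single point of the exceptional divisor, and it is visible on the
  slice \<open>w\<^sub>2 = 0\<close> of the first chart. With \<open>r = \<bar>w\<^sub>1\<bar>\<^sup>2\<close> the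
  potential of \<open>m \<omega>\<close> on this slice is \<open>m (s - ln (1 + s))\<close>, where
  \<open>s = sqrt (1 + r\<^sup>2)\<close>.

  Near the point choose a holomorphic frame \<open>\<sigma>\<close> of the line bundle and write the elements of
  the orthonormal basis as \<open>s\<^sub>j = f\<^sub>j \<sigma>\<close>. The curvature condition says that
  \<open>ln h(\<sigma>, \<sigma>)\<close> and \<open>-m\<close> times the potential differ by a pluriharmonic function,
  which on the slice is \<open>2 Re Q\<close> with \<open>Q\<close> holomorphic
  (\<open>pluriharmonic_slice_eq_Re_holomorphic\<close>). If \<open>\<epsilon>\<close> is the constant \<open>c > 0\<close>,
  the functions \<open>F\<^sub>j = f\<^sub>j exp Q / sqrt c\<close> therefore satisfy
  \<open>\<Sum> \<bar>F\<^sub>j(z)\<bar>\<^sup>2 = P(\<bar>z\<bar>\<^sup>2)\<close> with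
  \<open>P(r) = exp (m s) / (1 + s) ^ m\<close>. Integrating over circles, Parseval's identity shows that
  every Taylor coefficient of \<open>P\<close> at \<open>0\<close> is a sum of squares
  (\<open>sum_of_squares_radial_nonneg\<close>).

  This is impossible, for any \<open>m > 0\<close>. By Pringsheim's theorem a power series with nonnegative
  coefficients cannot be continued analytically past its disc of convergence along the positive
  axis. Now \<open>P\<close> is analytic on the whole real line, but its circle of convergence has radius
  \<open>1\<close>, because of the branch points of \<open>s\<close> at \<open>\<plusminus>\<i>\<close>
  (\<open>EH_series_has_negative_coefficient\<close>).
\<close>

section \<open>Pringsheim's theorem\<close>

lemma sums_nonneg_Reals:
  fixes f :: "nat \<Rightarrow> complex"
  assumes "f sums s" "\<And>n. f n \<in> \<real>\<^sub>\<ge>\<^sub>0"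
  shows "s \<in> \<real>\<^sub>\<ge>\<^sub>0"
proof (rule closed_sequentially[OF closed_nonneg_Reals_complex])
  show "(\<Sum>i<n. f i) \<in> \<real>\<^sub>\<ge>\<^sub>0" for n
    using assms(2) by (induction n) auto
  show "(\<lambda>n. \<Sum>i<n. f i) \<longlonglongrightarrow> s"
    using assms(1) by (simp add: sums_def)
qed

lemma nonneg_Reals_fact_divide_power:
  assumes "(a :: complex) \<in> \<real>\<^sub>\<ge>\<^sub>0" "0 \<le> x"
  shows "a / fact n * of_real x ^ n \<in> \<real>\<^sub>\<ge>\<^sub>0"
proof -
  have "(fact n :: complex) = of_nat (fact n)" by simp
  then have "(fact n :: complex) \<in> \<real>\<^sub>\<ge>\<^sub>0" by (metis nonneg_Reals_of_nat_I)
  with assms show ?thesis by (intro nonneg_Reals_mult_I nonneg_Reals_divide_I nonneg_Reals_pow_I) auto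
qed

text \<open>
  Nonnegativity of the Taylor coefficients moves from \<open>0\<close> to any point \<open>x\<close> on the positive
  radius, since each derivative at \<open>x\<close> is the sum of a power series with nonnegative terms.
\<close>

lemma higher_deriv_nonneg_shift:
  assumes hol: "f holomorphic_on ball 0 R" and nn: "\<And>n. (deriv ^^ n) f 0 \<in> \<real>\<^sub>\<ge>\<^sub>0"
    and x: "0 \<le> x" "x < R"
  shows "(deriv ^^ n) f (of_real x) \<in> \<real>\<^sub>\<ge>\<^sub>0"
proof -
  have "(deriv ^^ n) f holomorphic_on ball 0 R"
    using hol by (rule holomorphic_higher_deriv) auto
  from holomorphic_power_series[OF this, of "of_real x"] x
  have "(\<lambda>k. (deriv ^^ k) ((deriv ^^ n) f) 0 / fact k * of_real x ^ k) sums (deriv ^^ n) f (of_real x)"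
    by simp
  then show ?thesis
  proof (rule sums_nonneg_Reals)
    fix k
    have "(deriv ^^ k) ((deriv ^^ n) f) 0 \<in> \<real>\<^sub>\<ge>\<^sub>0"
      using nn[of "k + n"] by (simp add: funpow_add)
    then show "(deriv ^^ k) ((deriv ^^ n) f) 0 / fact k * of_real x ^ k \<in> \<real>\<^sub>\<ge>\<^sub>0"
      using x by (intro nonneg_Reals_fact_divide_power)
  qed
qed

text \<open>
  Expanding at \<open>a\<close> makes \<open>f\<close> nonnegative on an interval that may reach beyond the disc around
  \<open>0\<close>. The lemma will be applied to remainders of Taylor polynomials.
\<close>

lemma nonneg_on_shifted_disc:
  assumes hol: "f holomorphic_on ball 0 R" and nn: "\<And>n. (deriv ^^ n) f 0 \<in> \<real>\<^sub>\<ge>\<^sub>0"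
    and a: "0 \<le> a" "a < R" and hol': "f holomorphic_on ball (of_real a) \<rho>"
    and x: "a \<le> x" "x < a + \<rho>"
  shows "f (of_real x) \<in> \<real>\<^sub>\<ge>\<^sub>0"
proof -
  have "of_real x \<in> ball (of_real a :: complex) \<rho>"
    using x by (simp add: dist_of_real dist_real_def)
  from holomorphic_power_series[OF hol' this]
  have "(\<lambda>n. (deriv ^^ n) f (of_real a) / fact n * of_real (x - a) ^ n) sums f (of_real x)"
    by simp
  then show ?thesis
    by (rule sums_nonneg_Reals)
      (use x in \<open>intro nonneg_Reals_fact_divide_power higher_deriv_nonneg_shift[OF hol nn a], auto\<close>)
qed

lemma higher_deriv_diff_taylor_polynomial:
  fixes K :: nat
  assumes hol: "f holomorphic_on ball 0 R" and R: "R > 0"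
  defines "T \<equiv> \<lambda>z. \<Sum>n<K. (deriv ^^ n) f 0 / fact n * z ^ n"
  shows "(deriv ^^ n) (\<lambda>z. f z - T z) 0 = (if n < K then 0 else (deriv ^^ n) f 0)"
proof -
  define F where "F = fps_expansion f 0"
  have f: "f has_fps_expansion F"
    unfolding F_def using hol R by (intro has_fps_expansion_fps_expansion[of "ball 0 R"]) auto
  have T: "T has_fps_expansion (\<Sum>n<K. fps_const ((deriv ^^ n) f 0 / fact n) * fps_X ^ n)"
    unfolding T_def by (intro fps_expansion_intros)
  have "(\<lambda>z. f z - T z) has_fps_expansion F - (\<Sum>n<K. fps_const ((deriv ^^ n) f 0 / fact n) * fps_X ^ n)"
    by (intro has_fps_expansion_diff f T)
  from fps_nth_fps_expansion[OF this, of n]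
  have "(deriv ^^ n) (\<lambda>z. f z - T z) 0 / fact n
      = (deriv ^^ n) f 0 / fact n - (\<Sum>k<K. (deriv ^^ k) f 0 / fact k * (if n = k then 1 else 0))"
    by (simp add: F_def fps_expansion_def fps_sum_nth fps_X_power_nth mult_delta_right)
  also have "\<dots> = (deriv ^^ n) f 0 / fact n - (if n < K then (deriv ^^ n) f 0 / fact n else 0)"
    by (simp add: mult_delta_right)
  finally show ?thesis by (auto split: if_splits)
qed

text \<open>
  Pringsheim's theorem: if \<open>f\<close> extends to a disc around a point \<open>a\<close> of the positive radius,
  then the Taylor series at \<open>0\<close> converges as far as that disc reaches. Subtracting a Taylor
  polynomial leaves a function whose coefficients are still nonnegative, so the remainder is
  nonnegative at every \<open>x\<close> between \<open>a\<close> and \<open>a + \<rho>\<close>; thus all partial sums at \<open>x\<close>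
  are bounded by \<open>f x\<close>, and having nonnegative terms they converge.
\<close>

lemma Pringsheim_extension:
  assumes hol: "f holomorphic_on ball 0 R" and nn: "\<And>n. (deriv ^^ n) f 0 \<in> \<real>\<^sub>\<ge>\<^sub>0"
    and a: "0 \<le> a" "a < R" and hol': "f holomorphic_on ball (of_real a) \<rho>" and \<rho>: "\<rho> > 0"
  obtains g where "g holomorphic_on ball 0 (a + \<rho>)" "\<And>z. z \<in> ball 0 (min R (a + \<rho>)) \<Longrightarrow> g z = f z"
proof -
  define c where "c n = (deriv ^^ n) f 0 / fact n" for n
  define g where "g z = (\<Sum>n. c n * z ^ n)" for z
  have R: "R > 0" using a by simp
  have c_nn: "c n \<in> \<real>\<^sub>\<ge>\<^sub>0" for n
    using nonneg_Reals_fact_divide_power[OF nn[of n], of 1 n] by (simp add: c_def)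
  have summable: "summable (\<lambda>n. c n * of_real x ^ n)" if x: "a \<le> x" "x < a + \<rho>" for x
  proof (rule summable_norm_cancel, rule summableI_nonneg_bounded)
    fix K
    define T where "T z = (\<Sum>n<K. c n * z ^ n)" for z
    have "(\<lambda>z. f z - T z) (of_real x) \<in> \<real>\<^sub>\<ge>\<^sub>0"
    proof (rule nonneg_on_shifted_disc[where R = R])
      show "(\<lambda>z. f z - T z) holomorphic_on ball 0 R" "(\<lambda>z. f z - T z) holomorphic_on ball (of_real a) \<rho>"
        unfolding T_def using hol hol' by (auto intro!: holomorphic_intros)
      show "(deriv ^^ n) (\<lambda>z. f z - T z) 0 \<in> \<real>\<^sub>\<ge>\<^sub>0" for n
        using higher_deriv_diff_taylor_polynomial[OF hol R, of n K] nn[of n]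
        by (simp add: T_def c_def)
    qed (use a x in auto)
    moreover have "norm (c n * of_real x ^ n) = Re (c n * of_real x ^ n)" for n
      using c_nn[of n] a x by (intro nonneg_Reals_cmod_eq_Re nonneg_Reals_mult_I nonneg_Reals_pow_I) auto
    then have "(\<Sum>n<K. norm (c n * of_real x ^ n)) = Re (T (of_real x))"
      by (simp add: T_def)
    ultimately show "(\<Sum>n<K. norm (c n * of_real x ^ n)) \<le> Re (f (of_real x))"
      by (simp add: complex_nonneg_Reals_iff)
  qed auto
  have sums: "(\<lambda>n. c n * (z - 0) ^ n) sums g z" if z: "z \<in> ball 0 (a + \<rho>)" for z
  proof -
    obtain x where "max a (norm z) < x" "x < a + \<rho>"
      using dense[of "max a (norm z)" "a + \<rho>"] \<rho> z by auto
    then have "summable (\<lambda>n. c n * z ^ n)"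
      using powser_inside[OF summable[of x], of z] by auto
    then show ?thesis by (simp add: g_def summable_sums)
  qed
  show ?thesis
  proof
    show "g holomorphic_on ball 0 (a + \<rho>)"
      using sums by (rule power_series_holomorphic)
    show "g z = f z" if "z \<in> ball 0 (min R (a + \<rho>))" for z
      using holomorphic_power_series[OF hol, of z] sums[of z] that
      by (auto simp: c_def dest: sums_unique2)
  qed
qed

section \<open>The exponential of the potential on the slice\<close>

text \<open>
  On the slice \<open>w\<^sub>2 = 0\<close> this is the exponential of \<open>m\<close> times the potential, as a function
  of \<open>z = \<bar>w\<^sub>1\<bar>\<^sup>2\<close>, continued to complex \<open>z\<close>.
\<close>

definition EH_series :: "nat \<Rightarrow> complex \<Rightarrow> complex" where
  "EH_series m z = exp (of_nat m * csqrt (1 + z\<^sup>2)) / (1 + csqrt (1 + z\<^sup>2)) ^ m"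

lemma csqrt_plus_one_nonzero: "1 + csqrt w \<noteq> 0"
proof
  assume "1 + csqrt w = 0"
  then have "csqrt w = -1" by (simp add: eq_neg_iff_add_eq_0 add.commute)
  then show False using Re_csqrt[of w] by simp
qed

lemma EH_series_has_field_derivative:
  assumes "1 + z\<^sup>2 \<notin> \<real>\<^sub>\<le>\<^sub>0"
  shows "(EH_series m has_field_derivative
    of_nat m * z / (1 + csqrt (1 + z\<^sup>2)) * EH_series m z) (at z)"
proof -
  define s where "s = csqrt (1 + z\<^sup>2)"
  have s: "s \<noteq> 0" "1 + s \<noteq> 0" "s\<^sup>2 = 1 + z\<^sup>2"
    using assms csqrt_plus_one_nonzero[of "1 + z\<^sup>2"] by (auto simp: s_def)
  have root: "((\<lambda>z. csqrt (1 + z\<^sup>2)) has_field_derivative z / s) (at z)"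
    using assms s by (auto intro!: derivative_eq_intros simp: s_def field_simps)
  have "((\<lambda>z. exp (of_nat m * csqrt (1 + z\<^sup>2)) / (1 + csqrt (1 + z\<^sup>2)) ^ m) has_field_derivative
      (exp (of_nat m * s) * (of_nat m * (z / s)) * (1 + s) ^ m
        - exp (of_nat m * s) * (of_nat m * (1 + s) ^ (m - 1) * (z / s))) / ((1 + s) ^ m * (1 + s) ^ m)) (at z)"
    using s(1,2) root[unfolded s_def] assms
    by (auto intro!: derivative_eq_intros simp: s_def[symmetric] ac_simps)
  also have "(exp (of_nat m * s) * (of_nat m * (z / s)) * (1 + s) ^ m
        - exp (of_nat m * s) * (of_nat m * (1 + s) ^ (m - 1) * (z / s))) / ((1 + s) ^ m * (1 + s) ^ m)
     = of_nat m * z / (1 + s) * (exp (of_nat m * s) / (1 + s) ^ m)"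
  proof (cases m)
    case (Suc k)
    define E where "E = exp (of_nat m * s)"
    define D where "D = (1 + s) ^ k"
    have "E * (of_nat m * (z / s)) * ((1 + s) * D) - E * (of_nat m * D * (z / s)) = of_nat m * z * E * D"
      using s(1) by (simp add: field_simps)
    moreover have "D \<noteq> 0" using s(2) by (simp add: D_def)
    ultimately show ?thesis
      using s(2) Suc unfolding E_def[symmetric] by (simp add: D_def[symmetric])
  qed auto
  finally show ?thesis unfolding s_def EH_series_def .
qed

lemma EH_series_holomorphic:
  assumes "open S" "\<And>z. z \<in> S \<Longrightarrow> 1 + z\<^sup>2 \<notin> \<real>\<^sub>\<le>\<^sub>0"
  shows "EH_series m holomorphic_on S"
  using assms EH_series_has_field_derivative by (auto simp: holomorphic_on_open)

text \<open>
  The branch cut of \<open>csqrt (1 + z\<^sup>2)\<close> consists of the two rays on the imaginary axis that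
  start at the branch points \<open>\<plusminus>\<i>\<close>.
\<close>

lemma slit_iff: "1 + (z::complex)\<^sup>2 \<in> \<real>\<^sub>\<le>\<^sub>0 \<longleftrightarrow> Re z = 0 \<and> 1 \<le> \<bar>Im z\<bar>"
proof -
  have "1 \<le> \<bar>Im z\<bar> \<longleftrightarrow> 1 \<le> (Im z)\<^sup>2" using abs_le_square_iff[of 1 "Im z"] by simp
  moreover have "1 + (Re z)\<^sup>2 > 0" by (simp add: add_pos_nonneg)
  ultimately show ?thesis
    by (auto simp: complex_nonpos_Reals_iff power2_eq_square)
qed

lemma slit_avoids_unit_disc: "(z::complex) \<in> ball 0 1 \<Longrightarrow> 1 + z\<^sup>2 \<notin> \<real>\<^sub>\<le>\<^sub>0"
  using abs_Im_le_cmod[of z] by (auto simp: slit_iff)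

text \<open>
  The distance from \<open>1/2\<close> to the cut is \<open>sqrt 5 / 2 > 11/10\<close>. This disc reaches up to
  \<open>8/5\<close> on the real axis, well beyond the unit disc.
\<close>

lemma slit_avoids_shifted_disc:
  assumes "(z::complex) \<in> ball (of_real (1/2)) (11/10)"
  shows "1 + z\<^sup>2 \<notin> \<real>\<^sub>\<le>\<^sub>0"
proof
  assume "1 + z\<^sup>2 \<in> \<real>\<^sub>\<le>\<^sub>0"
  then have z: "Re z = 0" "1 \<le> \<bar>Im z\<bar>" by (auto simp: slit_iff)
  then have "1 \<le> (Im z)\<^sup>2" using abs_le_square_iff[of 1 "Im z"] by simp
  then have "(cmod (of_real (1/2) - z))\<^sup>2 \<ge> (11/10)\<^sup>2"
    unfolding cmod_power2 using z by (simp add: power2_eq_square)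
  then have "cmod (of_real (1/2) - z) \<ge> 11/10"
    by (rule power2_le_imp_le) auto
  then show False using assms by (simp add: dist_norm)
qed

text \<open>
  With nonnegative coefficients, \<open>P\<close> (that is, \<open>EH_series m\<close>) would extend holomorphically
  past \<open>\<i>\<close>. Its differential equation \<open>(1 + s) P' = m z P\<close> gives
  \<open>s P' = m z P - P'\<close>, and squaring removes the root:
  \<open>(1 + z\<^sup>2) P'\<^sup>2 = (m z P - P')\<^sup>2\<close>, an identity that persists at \<open>\<i>\<close>. There it
  says \<open>P' = m \<i> P\<close>, while its derivative says \<open>2 \<i> P'\<^sup>2 = 0\<close>. So \<open>P(\<i>) = 0\<close>, whereas
  \<open>P(z)\<close> tends to \<open>1\<close> as \<open>z\<close> approaches \<open>\<i>\<close> along the imaginary axis, because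
  \<open>s\<close> tends to \<open>0\<close>.
\<close>

proposition EH_series_has_negative_coefficient:
  assumes m: "m > 0"
  shows "\<exists>n. (deriv ^^ n) (EH_series m) 0 \<notin> \<real>\<^sub>\<ge>\<^sub>0"
proof (rule ccontr)
  assume "\<nexists>n. (deriv ^^ n) (EH_series m) 0 \<notin> \<real>\<^sub>\<ge>\<^sub>0"
  then have nn: "(deriv ^^ n) (EH_series m) 0 \<in> \<real>\<^sub>\<ge>\<^sub>0" for n by blast
  obtain f where f: "f holomorphic_on ball 0 (8/5)"
    and eq: "\<And>z. z \<in> ball 0 1 \<Longrightarrow> f z = EH_series m z"
  proof (rule Pringsheim_extension[OF _ nn, of 1 "1/2" "11/10"])
    show "EH_series m holomorphic_on ball 0 1" "EH_series m holomorphic_on ball (of_real (1/2)) (11/10)"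
      using slit_avoids_unit_disc slit_avoids_shifted_disc by (intro EH_series_holomorphic; blast)+
  qed auto
  define B where "B = ball (0::complex) (8/5)"
  have B: "open B" "connected B" "\<i> \<in> B" "0 \<in> B" by (auto simp: B_def)
  have f': "(f has_field_derivative deriv f z) (at z)" if "z \<in> B" for z
    using f that B by (auto simp: B_def intro: holomorphic_derivI)
  have f'': "(deriv f has_field_derivative deriv (deriv f) z) (at z)" if "z \<in> B" for z
    using f that by (auto simp: B_def intro!: holomorphic_derivI holomorphic_deriv)
  define M where "M = (of_nat m :: complex)"
  have M: "M \<noteq> 0" using m by (simp add: M_def)
  define \<Delta> where "\<Delta> z = (1 + z\<^sup>2) * (deriv f z)\<^sup>2 - (M * z * f z - deriv f z)\<^sup>2" for z
  have \<Delta>0: "\<Delta> z = 0" if "z \<in> ball 0 1" for z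
  proof -
    define s where "s = csqrt (1 + z\<^sup>2)"
    have s: "1 + s \<noteq> 0" "s\<^sup>2 = 1 + z\<^sup>2"
      using csqrt_plus_one_nonzero by (auto simp: s_def)
    have "(f has_field_derivative M * z / (1 + s) * f z) (at z)"
      using EH_series_has_field_derivative[OF slit_avoids_unit_disc[OF that], of m]
        eq that unfolding s_def M_def
      by (subst has_field_derivative_cong_ev[OF refl _ refl, where g = "EH_series m"])
         (auto intro: eventually_nhds_in_open[THEN eventually_mono, of "ball 0 1"])
    then have "deriv f z = M * z / (1 + s) * f z" by (rule DERIV_imp_deriv)
    then have "M * z * f z - deriv f z = s * deriv f z"
      using s by (simp add: field_simps)
    then show ?thesis using s by (simp add: \<Delta>_def power_mult_distrib)
  qed
  have "\<Delta> z = 0" if "z \<in> B" for z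
  proof (rule analytic_continuation_open[of "ball 0 1" B \<Delta> "\<lambda>_. 0"])
    show "\<Delta> holomorphic_on B"
      unfolding \<Delta>_def using f by (auto simp: B_def intro!: holomorphic_intros)
  qed (use B that \<Delta>0 in \<open>auto simp: B_def\<close>)
  then have \<Delta>: "\<Delta> \<i> = 0" and ev: "eventually (\<lambda>z. \<Delta> z = 0) (nhds \<i>)"
    using B eventually_nhds_in_open[of B \<i>] by (auto elim: eventually_mono)
  have f1: "deriv f \<i> = M * \<i> * f \<i>" using \<Delta> by (simp add: \<Delta>_def)
  have "(\<Delta> has_field_derivative
      2 * \<i> * (deriv f \<i>)\<^sup>2 - 2 * (M * \<i> * f \<i> - deriv f \<i>) * (M * f \<i> + M * \<i> * deriv f \<i> - deriv (deriv f) \<i>)) (at \<i>)"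
    unfolding \<Delta>_def using f'[OF B(3)] f''[OF B(3)]
    by (auto intro!: derivative_eq_intros simp: algebra_simps)
  moreover have "(\<Delta> has_field_derivative 0) (at \<i>)"
    using ev by (subst has_field_derivative_cong_ev[OF refl _ refl, where g = "\<lambda>_. 0"]) auto
  ultimately have "2 * \<i> * (deriv f \<i>)\<^sup>2 = 0"
    using f1 by (auto dest: DERIV_unique)
  then have fi: "f \<i> = 0" using f1 M by simp
  have lim1: "((\<lambda>y. f (\<i> * of_real y)) \<longlongrightarrow> f (\<i> * of_real 1)) (at_left 1)"
  proof -
    have "isCont f (\<i> * of_real 1)" using f'[OF B(3)] by (simp add: DERIV_isCont)
    then show ?thesis by (rule isCont_tendsto_compose) (intro tendsto_intros)
  qed
  have "((\<lambda>y::real. exp (M * of_real (sqrt (1 - y\<^sup>2))) / (1 + of_real (sqrt (1 - y\<^sup>2))) ^ m) \<longlongrightarrow>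
      exp (M * of_real (sqrt (1 - 1\<^sup>2))) / (1 + of_real (sqrt (1 - 1\<^sup>2))) ^ m) (at_left 1)"
    by (intro tendsto_intros) auto
  moreover have "eventually (\<lambda>y. f (\<i> * of_real y) = exp (M * of_real (sqrt (1 - y\<^sup>2))) / (1 + of_real (sqrt (1 - y\<^sup>2))) ^ m) (at_left (1::real))"
  proof -
    have "eventually (\<lambda>y. y \<in> {0<..<1}) (at_left (1::real))"
      by (rule eventually_at_leftI[of 0]) auto
    then show ?thesis
    proof eventually_elim
      case (elim y)
      then have "y\<^sup>2 \<le> 1" by (simp add: power_le_one)
      then have "csqrt (1 + (\<i> * of_real y)\<^sup>2) = of_real (sqrt (1 - y\<^sup>2))"
        using csqrt_of_real_nonneg[of "of_real (1 - y\<^sup>2)"] by (simp add: power_mult_distrib)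
      then show ?case using eq[of "\<i> * of_real y"] elim
        by (simp add: EH_series_def M_def norm_mult)
    qed
  qed
  ultimately have "((\<lambda>y. f (\<i> * of_real y)) \<longlongrightarrow> 1) (at_left 1)"
    by (subst tendsto_cong) auto
  with lim1 have "f \<i> = 1" by (auto intro: tendsto_unique[OF trivial_limit_at_left_real])
  with fi show False by simp
qed

section \<open>Radial sums of squares of holomorphic functions\<close>

text \<open>
  Cauchy's formula for the Taylor coefficients, written as an integral over the angle.
\<close>

lemma circle_Fourier_coefficient:
  assumes hol: "F holomorphic_on ball 0 R" and t: "0 < t" "t < R"
  shows "((\<lambda>\<theta>. F (of_real t * cis \<theta>) * cnj (cis \<theta> ^ k)) has_integral
    2 * of_real pi * ((deriv ^^ k) F 0 / fact k * of_real t ^ k)) {0..2 * pi}"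
proof -
  have "((\<lambda>u. F u / (u - 0) ^ Suc k) has_contour_integral 2 * pi * \<i> / fact k * (deriv ^^ k) F 0)
      (circlepath 0 t)"
    using t by (intro Cauchy_has_contour_integral_higher_derivative_circlepath
      holomorphic_on_imp_continuous_on holomorphic_on_subset[OF hol]) auto
  then have "((\<lambda>\<theta>. F (of_real t * cis \<theta>) / (of_real t * cis \<theta>) ^ Suc k * of_real t * \<i> * cis \<theta>)
      has_integral 2 * pi * \<i> / fact k * (deriv ^^ k) F 0) {0..2 * pi}"
    unfolding circlepath_def by (subst (asm) has_contour_integral_part_circlepath_iff) auto
  from has_integral_mult_right[OF this, of "of_real t ^ k / \<i>"]
  have "((\<lambda>\<theta>. of_real t ^ k / \<i> * (F (of_real t * cis \<theta>) / (of_real t * cis \<theta>) ^ Suc k * of_real t * \<i> * cis \<theta>))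
      has_integral 2 * of_real pi * ((deriv ^^ k) F 0 / fact k * of_real t ^ k)) {0..2 * pi}"
    by (simp add: ac_simps)
  moreover have "of_real t ^ k / \<i> * (F (of_real t * cis \<theta>) / (of_real t * cis \<theta>) ^ Suc k * of_real t * \<i> * cis \<theta>)
      = F (of_real t * cis \<theta>) * cnj (cis \<theta> ^ k)" for \<theta>
  proof -
    have "cnj (cis \<theta> ^ k) = 1 / cis \<theta> ^ k"
      by (simp add: cis_cnj cis_inverse divide_inverse flip: power_inverse)
    then show ?thesis using t by (simp add: power_mult_distrib field_simps)
  qed
  ultimately show ?thesis by simp
qed

lemma circle_Parseval:
  assumes hol: "F holomorphic_on ball 0 R" and t: "0 < t" "t < R"
  defines "a \<equiv> \<lambda>k. (deriv ^^ k) F 0 / fact k"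
  obtains S where "(\<lambda>k. (cmod (a k))\<^sup>2 * (t\<^sup>2) ^ k) sums S"
    "((\<lambda>\<theta>. (cmod (F (of_real t * cis \<theta>)))\<^sup>2) has_integral 2 * pi * S) {0..2 * pi}"
proof -
  define z where "z \<theta> = of_real t * cis \<theta>" for \<theta>
  have z: "z \<theta> \<in> ball 0 R" "cmod (z \<theta>) = t" for \<theta> using t by (auto simp: z_def norm_mult)
  have cont: "continuous_on A (\<lambda>\<theta>. F (z \<theta>))" for A
    by (rule continuous_on_compose2[OF holomorphic_on_imp_continuous_on[OF hol]])
       (use z in \<open>auto simp: z_def intro!: continuous_intros\<close>)
  obtain M where M: "\<And>\<theta>. \<theta> \<in> {0..2 * pi} \<Longrightarrow> cmod (F (z \<theta>)) \<le> M"
    using compact_continuous_image[OF cont compact_Icc, THEN compact_imp_bounded, of 0 "2 * pi"]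
    unfolding bounded_iff by (metis imageI)
  have ser: "(\<lambda>k. a k * w ^ k) sums F w" if "w \<in> ball 0 R" for w
    using holomorphic_power_series[OF hol that] by (simp add: a_def)
  have summ: "summable (\<lambda>k. M * (cmod (a k) * t ^ k))"
  proof -
    obtain r where r: "t < r" "r < R" using dense t by blast
    have "summable (\<lambda>k. a k * of_real r ^ k)" using ser[of "of_real r"] r t by (auto simp: sums_iff)
    from powser_insidea[OF this, of "of_real t"] show ?thesis
      using t r by (intro summable_mult) (simp add: norm_mult norm_power)
  qed
  define G where "G k \<theta> = F (z \<theta>) * cnj (a k * z \<theta> ^ k)" for k \<theta>
  have G_int: "(G k has_integral of_real (2 * pi * ((cmod (a k))\<^sup>2 * (t\<^sup>2) ^ k))) {0..2 * pi}" for k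
  proof -
    have "G k = (\<lambda>\<theta>. cnj (a k) * of_real t ^ k * (F (z \<theta>) * cnj (cis \<theta> ^ k)))"
      by (simp add: G_def z_def fun_eq_iff power_mult_distrib)
    moreover have "complex_of_real (2 * pi * ((cmod (a k))\<^sup>2 * (t\<^sup>2) ^ k))
        = cnj (a k) * of_real t ^ k * (2 * of_real pi * (a k * of_real t ^ k))"
    proof -
      have "complex_of_real ((cmod (a k))\<^sup>2) = a k * cnj (a k)" by (rule complex_norm_square)
      moreover have "complex_of_real ((t\<^sup>2) ^ k) = of_real t ^ k * of_real t ^ k"
        by (simp add: power2_eq_square power_mult_distrib)
      ultimately show ?thesis by (simp del: of_real_power)
    qed
    ultimately show ?thesis
      using has_integral_mult_right[OF circle_Fourier_coefficient[OF hol t, of k], of "cnj (a k) * of_real t ^ k"]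
      by (simp only: a_def z_def)
  qed
  have "uniform_limit {0..2 * pi} (\<lambda>n \<theta>. \<Sum>k<n. G k \<theta>) (\<lambda>\<theta>. suminf (\<lambda>k. G k \<theta>)) sequentially"
  proof (rule Weierstrass_m_test[OF _ summ])
    show "cmod (G k \<theta>) \<le> M * (cmod (a k) * t ^ k)" if "\<theta> \<in> {0..2 * pi}" for k \<theta>
      using M[OF that] t by (auto simp: G_def norm_mult norm_power z intro!: mult_right_mono)
  qed
  moreover have "suminf (\<lambda>k. G k \<theta>) = of_real ((cmod (F (z \<theta>)))\<^sup>2)" for \<theta>
  proof -
    have "(\<lambda>k. G k \<theta>) sums (F (z \<theta>) * cnj (F (z \<theta>)))"
      unfolding G_def using ser[OF z(1)] by (intro sums_mult) (simp only: sums_cnj)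
    then show ?thesis by (simp add: sums_iff complex_norm_square del: of_real_power)
  qed
  ultimately have lim: "uniform_limit {0..2 * pi} (\<lambda>n \<theta>. \<Sum>k<n. G k \<theta>) (\<lambda>\<theta>. of_real ((cmod (F (z \<theta>)))\<^sup>2)) sequentially"
    by simp
  obtain I J where IJ: "\<And>n. ((\<lambda>\<theta>. \<Sum>k<n. G k \<theta>) has_integral I n) {0..2 * pi}"
    "((\<lambda>\<theta>. complex_of_real ((cmod (F (z \<theta>)))\<^sup>2)) has_integral J) {0..2 * pi}" "I \<longlonglongrightarrow> J"
    by (rule uniform_limit_integral[OF lim])
       (use cont in \<open>auto simp: G_def z_def intro!: continuous_intros\<close>)
  have I_eq: "I n = (\<Sum>k<n. of_real (2 * pi * ((cmod (a k))\<^sup>2 * (t\<^sup>2) ^ k)))" for n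
    by (rule has_integral_unique[OF IJ(1) has_integral_sum[OF finite_lessThan G_int]])
  have "(\<lambda>k. complex_of_real (2 * pi * ((cmod (a k))\<^sup>2 * (t\<^sup>2) ^ k))) sums J"
    using IJ(3) unfolding sums_def I_eq[symmetric] .
  from sums_Re[OF this] have "(\<lambda>k. 2 * pi * ((cmod (a k))\<^sup>2 * (t\<^sup>2) ^ k)) sums Re J"
    by (simp only: Re_complex_of_real)
  from sums_divide[OF this, of "2 * pi"]
  have 1: "(\<lambda>k. (cmod (a k))\<^sup>2 * (t\<^sup>2) ^ k) sums (Re J / (2 * pi))" by simp
  from has_integral_linear[OF IJ(2) bounded_linear_Re]
  have 2: "((\<lambda>\<theta>. (cmod (F (z \<theta>)))\<^sup>2) has_integral Re J) {0..2 * pi}" by (simp add: o_def)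
  show ?thesis by (rule that[OF 1]) (use 2 in \<open>simp add: z_def\<close>)
qed

text \<open>
  Averaging a radial sum of squares over the circle of radius \<open>sqrt r\<close> leaves it unchanged and
  turns each \<open>\<bar>F\<^sub>j\<bar>\<^sup>2\<close> into a power series in \<open>r\<close> with coefficients
  \<open>\<bar>a\<^sub>j\<^sub>k\<bar>\<^sup>2\<close>. All terms are nonnegative, so integral and sums may be exchanged, and
  the coefficient of \<open>r ^ k\<close> becomes \<open>\<Sum>\<^sub>j \<bar>a\<^sub>j\<^sub>k\<bar>\<^sup>2\<close>. The computation takes place in
  the extended nonnegative reals, where finiteness of the coefficients is a consequence.
\<close>

lemma sum_of_squares_radial_sums:
  fixes F :: "nat \<Rightarrow> complex \<Rightarrow> complex" and p :: "real \<Rightarrow> real"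
  assumes hol: "\<And>j. F j holomorphic_on ball 0 R" and R: "R > 0"
    and sq: "\<And>w. w \<in> ball 0 R \<Longrightarrow> (\<lambda>j. (cmod (F j w))\<^sup>2) sums p ((cmod w)\<^sup>2)"
  obtains A :: "nat \<Rightarrow> real" where "\<And>k. A k \<ge> 0"
    "\<And>r. 0 < r \<Longrightarrow> r < R\<^sup>2 \<Longrightarrow> (\<lambda>k. A k * r ^ k) sums p r"
proof -
  define a where "a j k = (deriv ^^ k) (F j) 0 / fact k" for j k
  have key: "(\<Sum>k. (\<Sum>j. ennreal ((cmod (a j k))\<^sup>2)) * ennreal (r ^ k)) = ennreal (p r)" and p_nn: "p r \<ge> 0"
    if r: "0 < r" "r < R\<^sup>2" for r
  proof -
    define t where "t = sqrt r"
    have t: "0 < t" "t < R" "t\<^sup>2 = r"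
      using r R by (auto simp: t_def real_sqrt_less_iff intro: real_less_lsqrt)
    have sq_t: "(\<lambda>j. (cmod (F j (of_real t * cis \<theta>)))\<^sup>2) sums p r" for \<theta>
      using sq[of "of_real t * cis \<theta>"] t by (simp add: norm_mult)
    show p_nn: "p r \<ge> 0" using sums_le[OF _ sums_zero sq_t] by auto
    define S where "S j = (\<Sum>k. (cmod (a j k))\<^sup>2 * r ^ k)" for j
    have S: "(\<lambda>k. (cmod (a j k))\<^sup>2 * r ^ k) sums S j"
      and int: "((\<lambda>\<theta>. (cmod (F j (of_real t * cis \<theta>)))\<^sup>2) has_integral 2 * pi * S j) {0..2 * pi}" for j
    proof -
      obtain S' where S': "(\<lambda>k. (cmod (a j k))\<^sup>2 * r ^ k) sums S'"
        and int: "((\<lambda>\<theta>. (cmod (F j (of_real t * cis \<theta>)))\<^sup>2) has_integral 2 * pi * S') {0..2 * pi}"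
        by (rule circle_Parseval[OF hol[of j] t(1,2)]) (unfold t(3) a_def[symmetric])
      have "S' = S j" using S' by (simp add: S_def sums_unique)
      with S' int show "(\<lambda>k. (cmod (a j k))\<^sup>2 * r ^ k) sums S j"
        "((\<lambda>\<theta>. (cmod (F j (of_real t * cis \<theta>)))\<^sup>2) has_integral 2 * pi * S j) {0..2 * pi}" by simp_all
    qed
    have S_eq: "ennreal (S j) = (\<Sum>k. ennreal ((cmod (a j k))\<^sup>2 * r ^ k))" for j
      using r by (intro suminf_ennreal_eq[symmetric] S) auto
    have cont: "continuous_on UNIV (\<lambda>\<theta>. F j (of_real t * cis \<theta>))" for j
      by (rule continuous_on_compose2[OF holomorphic_on_imp_continuous_on[OF hol]])
         (use t in \<open>auto simp: norm_mult intro!: continuous_intros\<close>)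
    have meas: "(\<lambda>\<theta>. ennreal ((cmod (F j (of_real t * cis \<theta>)))\<^sup>2) * indicator {0..2 * pi} \<theta>) \<in> borel_measurable lborel" for j
    proof -
      have [measurable]: "(\<lambda>\<theta>. F j (of_real t * cis \<theta>)) \<in> borel_measurable borel"
        using cont by (rule borel_measurable_continuous_onI)
      show ?thesis by measurable
    qed
    have "ennreal (2 * pi) * ennreal (p r) = (\<integral>\<^sup>+\<theta>. ennreal (p r) * indicator {0..2 * pi} \<theta> \<partial>lborel)"
      by (simp add: nn_integral_cmult_indicator ennreal_mult' mult.commute)
    also have "\<dots> = (\<integral>\<^sup>+\<theta>. (\<Sum>j. ennreal ((cmod (F j (of_real t * cis \<theta>)))\<^sup>2) * indicator {0..2 * pi} \<theta>) \<partial>lborel)"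
      by (intro nn_integral_cong) (simp only: ennreal_suminf_multc suminf_ennreal_eq[OF zero_le_power2 sq_t])
    also have "\<dots> = (\<Sum>j. \<integral>\<^sup>+\<theta>. ennreal ((cmod (F j (of_real t * cis \<theta>)))\<^sup>2) * indicator {0..2 * pi} \<theta> \<partial>lborel)"
      using meas by (rule nn_integral_suminf)
    also have "\<dots> = (\<Sum>j. ennreal (2 * pi * S j))"
      by (intro suminf_cong nn_integral_has_integral_lebesgue' int) auto
    also have "\<dots> = ennreal (2 * pi) * (\<Sum>j. ennreal (S j))"
      by (simp add: ennreal_mult' del: ennreal_suminf_cmult flip: ennreal_suminf_cmult)
    finally have "ennreal (p r) = (\<Sum>j. ennreal (S j))"
      by (subst (asm) ennreal_mult_cancel_left) auto
    also have "\<dots> = (\<integral>\<^sup>+j. (\<Sum>k. ennreal ((cmod (a j k))\<^sup>2 * r ^ k)) \<partial>count_space UNIV)"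
      by (simp add: S_eq nn_integral_count_space_nat)
    also have "\<dots> = (\<Sum>k. \<integral>\<^sup>+j. ennreal ((cmod (a j k))\<^sup>2 * r ^ k) \<partial>count_space UNIV)"
      by (rule nn_integral_suminf) auto
    also have "\<dots> = (\<Sum>k. (\<Sum>j. ennreal ((cmod (a j k))\<^sup>2)) * ennreal (r ^ k))"
      using r by (simp add: nn_integral_count_space_nat ennreal_mult del: ennreal_power)
    finally show "(\<Sum>k. (\<Sum>j. ennreal ((cmod (a j k))\<^sup>2)) * ennreal (r ^ k)) = ennreal (p r)" ..
  qed
  define A where "A k = enn2real (\<Sum>j. ennreal ((cmod (a j k))\<^sup>2))" for k
  have A: "ennreal (A k) = (\<Sum>j. ennreal ((cmod (a j k))\<^sup>2))" for k
  proof -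
    \<comment> \<open>Any one admissible radius bounds the coefficient, since every term of the convergent sum is finite.\<close>
    define r where "r = R\<^sup>2 / 2"
    have r: "0 < r" "r < R\<^sup>2" using R by (auto simp: r_def)
    have "(\<Sum>k. (\<Sum>j. ennreal ((cmod (a j k))\<^sup>2)) * ennreal (r ^ k)) < top"
      by (simp add: key[OF r] del: ennreal_power)
    then have "(\<Sum>j. ennreal ((cmod (a j k))\<^sup>2)) * ennreal (r ^ k) < top"
      by (rule ennreal_suminf_lessD)
    then have "(\<Sum>j. ennreal ((cmod (a j k))\<^sup>2)) \<noteq> top"
      using r by (auto simp: ennreal_top_mult simp del: ennreal_power)
    then show ?thesis by (simp add: A_def ennreal_enn2real_if)
  qed
  show ?thesis
  proof
    show A_nn: "A k \<ge> 0" for k by (simp add: A_def)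
    fix r assume r: "0 < r" "r < R\<^sup>2"
    have nn: "A k * r ^ k \<ge> 0" for k using r A_nn by simp
    have eq: "(\<Sum>k. ennreal (A k * r ^ k)) = ennreal (p r)"
      using key[OF r] r by (simp add: A[symmetric] ennreal_mult A_nn del: ennreal_power)
    then have "summable (\<lambda>k. A k * r ^ k)"
      using nn by (intro summable_suminf_not_top) auto
    then show "(\<lambda>k. A k * r ^ k) sums p r"
      using eq nn p_nn[OF r] by (simp add: suminf_ennreal2 suminf_nonneg sums_iff del: ennreal_power)
  qed
qed

text \<open>
  On a short real interval \<open>P\<close> agrees with the power series of the previous lemma, hence by
  analytic continuation the two have the same Taylor coefficients.
\<close>

proposition sum_of_squares_radial_nonneg:
  fixes F :: "nat \<Rightarrow> complex \<Rightarrow> complex" and P :: "complex \<Rightarrow> complex"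
  assumes hol: "\<And>j. F j holomorphic_on ball 0 R" and R: "R > 0"
    and P: "P holomorphic_on ball 0 R'" and R': "R' > 0"
    and sq: "\<And>w. w \<in> ball 0 R \<Longrightarrow>
      (\<lambda>j. of_real ((cmod (F j w))\<^sup>2)) sums P (of_real ((cmod w)\<^sup>2))"
  shows "(deriv ^^ n) P 0 \<in> \<real>\<^sub>\<ge>\<^sub>0"
proof -
  have sq': "(\<lambda>j. (cmod (F j w))\<^sup>2) sums Re (P (of_real ((cmod w)\<^sup>2)))" if "w \<in> ball 0 R" for w
    using sums_Re[OF sq[OF that]] by (simp only: Re_complex_of_real)
  obtain A :: "nat \<Rightarrow> real" where A: "\<And>k. A k \<ge> 0"
    "\<And>r. 0 < r \<Longrightarrow> r < R\<^sup>2 \<Longrightarrow> (\<lambda>k. A k * r ^ k) sums Re (P (of_real r))"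
    using sum_of_squares_radial_sums[OF hol R sq'] by blast
  have real: "of_real (Re (P (of_real r))) = P (of_real r)" if r: "0 < r" "r < R\<^sup>2" for r
  proof -
    have "of_real (sqrt r) \<in> ball (0::complex) R"
      using r R by (auto intro: real_less_lsqrt)
    from sq[OF this] have s: "(\<lambda>j. of_real ((cmod (F j (of_real (sqrt r))))\<^sup>2)) sums P (of_real r)"
      using r by (simp del: of_real_power)
    from sums_Im[OF s] have "Im (P (of_real r)) = 0"
      by (simp only: Im_complex_of_real) (auto dest: sums_unique2[OF sums_zero])
    then show ?thesis by (simp add: complex_eq_iff)
  qed
  define \<rho> where "\<rho> = min R' (R\<^sup>2)"
  have \<rho>: "\<rho> > 0" "\<rho> \<le> R'" "\<rho> \<le> R\<^sup>2" using R R' by (auto simp: \<rho>_def)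
  define Q where "Q z = (\<Sum>k. of_real (A k) * z ^ k)" for z :: complex
  have Q: "(\<lambda>k. of_real (A k) * (z - 0) ^ k) sums Q z" if z: "z \<in> ball 0 \<rho>" for z
  proof -
    obtain r where r: "cmod z < r" "r < \<rho>" using z dense[of "cmod z" \<rho>] by auto
    then have r': "0 < r" "r < R\<^sup>2" using \<rho> norm_ge_zero[of z] by linarith+
    have "summable (\<lambda>k. complex_of_real (A k) * of_real r ^ k)"
      using sums_summable[OF A(2)[OF r']] by (simp flip: of_real_power of_real_mult)
    then have "summable (\<lambda>k. of_real (A k) * z ^ k)"
      by (rule powser_inside) (use r r' in auto)
    then show ?thesis by (simp add: Q_def summable_sums)
  qed
  have Qhol: "Q holomorphic_on ball 0 \<rho>" using Q by (rule power_series_holomorphic)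
  have QP: "Q (of_real r) = P (of_real r)" if r: "0 < r" "r < \<rho>" for r
  proof -
    have "(\<lambda>k. complex_of_real (A k * r ^ k)) sums of_real (Re (P (of_real r)))"
      using A(2)[of r] r \<rho> by (intro sums_of_real) auto
    then show ?thesis using Q[of "of_real r"] r \<rho> real[of r] by (auto dest: sums_unique2)
  qed
  have PQ: "P z - Q z = 0" if "z \<in> ball 0 \<rho>" for z
  proof (rule analytic_continuation[of "\<lambda>z. P z - Q z" "ball 0 \<rho>" "of_real ` {0<..<\<rho>}" 0])
    show "(\<lambda>z. P z - Q z) holomorphic_on ball 0 \<rho>"
      using Qhol \<rho> by (intro holomorphic_intros holomorphic_on_subset[OF P]) auto
    show "(0::complex) islimpt of_real ` {0<..<\<rho>}"
    proof (rule islimptI)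
      fix T :: "complex set" assume T: "0 \<in> T" "open T"
      then obtain e where e: "e > 0" "ball 0 e \<subseteq> T" by (auto simp: open_contains_ball)
      define x where "x = min e \<rho> / 2"
      have "0 < x" "x < \<rho>" "x < e" using e \<rho> by (auto simp: x_def)
      then show "\<exists>y\<in>of_real ` {0<..<\<rho>}. y \<in> T \<and> y \<noteq> 0"
        using e by (intro bexI[of _ "of_real x"]) auto
    qed
  qed (use \<rho> QP that in auto)
  have "eventually (\<lambda>z. z \<in> ball 0 \<rho>) (nhds (0::complex))"
    using \<rho> by (intro eventually_nhds_in_open) auto
  then have "eventually (\<lambda>z. P z = Q z) (nhds 0)"
    by eventually_elim (use PQ in simp)
  then have "(deriv ^^ n) P 0 = (deriv ^^ n) Q 0" by (rule higher_deriv_cong_ev) simp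
  also have "Q has_fps_expansion Abs_fps (\<lambda>k. complex_of_real (A k))"
  proof -
    have "summable (\<lambda>k. complex_of_real (A k) * of_real (\<rho> / 2) ^ k)"
      using sums_summable[OF Q[of "of_real (\<rho> / 2)"]] \<rho> by simp
    from conv_radius_geI[OF this] have "conv_radius (\<lambda>k. complex_of_real (A k)) \<ge> ereal (\<rho> / 2)"
      using \<rho> by simp
    moreover have "ereal (\<rho> / 2) > 0" using \<rho> by simp
    ultimately have "fps_conv_radius (Abs_fps (\<lambda>k. complex_of_real (A k))) > 0"
      unfolding fps_conv_radius_def fps_nth_Abs_fps by (rule less_le_trans[rotated])
    from eval_fps_has_fps_expansion[OF this] show ?thesis
      unfolding Q_def eval_fps_def by simp
  qed
  then have "(deriv ^^ n) Q 0 = of_real (fact n * A n)"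
    using fps_nth_fps_expansion[of Q "Abs_fps (\<lambda>k. complex_of_real (A k))" n] by (simp add: field_simps)
  finally have "(deriv ^^ n) P 0 = of_real (fact n * A n)" .
  moreover have "fact n * A n \<ge> 0" using A(1) by simp
  ultimately show ?thesis by (simp only: nonneg_Reals_of_real_iff)
qed

section \<open>Twofold differentiability\<close>

text \<open>
  The iterated derivatives in the curvature are linear in the potential only where these exist.
  The second condition asks for differentiability of every directional derivative of \<open>f\<close>; this
  form, with an explicit derivative \<open>f'\<close>, is preserved by algebraic operations on any set.
\<close>

definition twice_differentiable_on ::
    "('a::real_normed_vector \<Rightarrow> 'b::real_normed_vector) \<Rightarrow> 'a set \<Rightarrow> bool" where
  "twice_differentiable_on f U \<longleftrightarrow> (\<exists>f'. \<forall>x\<in>U. (f has_derivative f' x) (at x) \<and>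
     (\<forall>v. (\<lambda>y. f' y v) differentiable (at x)))"

lemma twice_differentiable_onI:
  assumes "\<And>x. x \<in> U \<Longrightarrow> (f has_derivative f' x) (at x)"
    and "\<And>x v. x \<in> U \<Longrightarrow> (\<lambda>y. f' y v) differentiable (at x)"
  shows "twice_differentiable_on f U"
  using assms unfolding twice_differentiable_on_def by blast

lemma twice_differentiable_onE:
  assumes "twice_differentiable_on f U"
  obtains f' where "\<And>x. x \<in> U \<Longrightarrow> (f has_derivative f' x) (at x)"
    and "\<And>x v. x \<in> U \<Longrightarrow> (\<lambda>y. f' y v) differentiable (at x)"
  using assms unfolding twice_differentiable_on_def by blast

lemma Ck_on_2_imp_twice_differentiable_on: "Ck_on 2 f U \<Longrightarrow> twice_differentiable_on f U"
  by (rule twice_differentiable_onI[where f' = "\<lambda>x. frechet_derivative f (at x)"])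
     (auto simp: numeral_2_eq_2 frechet_derivative_works)

lemma twice_differentiable_on_frechet_derivative:
  assumes "twice_differentiable_on f U" "open U" "x \<in> U"
  shows "f differentiable (at x)" "(\<lambda>y. frechet_derivative f (at y) v) differentiable (at x)"
proof -
  obtain f' where f': "\<And>x. x \<in> U \<Longrightarrow> (f has_derivative f' x) (at x)"
    "\<And>x v. x \<in> U \<Longrightarrow> (\<lambda>y. f' y v) differentiable (at x)"
    using assms(1) by (elim twice_differentiable_onE) blast
  show "f differentiable (at x)" using f'(1) assms(3) by (auto simp: differentiable_def)
  obtain D where "((\<lambda>y. f' y v) has_derivative D) (at x)"
    using f'(2)[OF assms(3), of v] by (auto simp: differentiable_def)
  then have "((\<lambda>y. frechet_derivative f (at y) v) has_derivative D) (at x)"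
    by (rule has_derivative_transform_within_open[OF _ assms(2,3)])
       (use f'(1) frechet_derivative_at in metis)
  then show "(\<lambda>y. frechet_derivative f (at y) v) differentiable (at x)"
    by (auto simp: differentiable_def)
qed

lemma twice_differentiable_on_const: "twice_differentiable_on (\<lambda>x. c) U"
  by (rule twice_differentiable_onI[where f' = "\<lambda>x v. 0"]) auto

lemma twice_differentiable_on_bounded_linear:
  assumes "bounded_linear f"
  shows "twice_differentiable_on f U"
  by (rule twice_differentiable_onI[where f' = "\<lambda>x. f"])
     (auto intro: bounded_linear_imp_has_derivative assms)

lemma twice_differentiable_on_linear_compose:
  assumes "bounded_linear L" "twice_differentiable_on f U"
  shows "twice_differentiable_on (\<lambda>x. L (f x)) U"
proof -
  obtain f' where f': "\<And>x. x \<in> U \<Longrightarrow> (f has_derivative f' x) (at x)"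
    "\<And>x v. x \<in> U \<Longrightarrow> (\<lambda>y. f' y v) differentiable (at x)"
    using assms(2) by (elim twice_differentiable_onE) blast
  show ?thesis
  proof (rule twice_differentiable_onI[where f' = "\<lambda>x v. L (f' x v)"])
    fix x assume x: "x \<in> U"
    show "((\<lambda>x. L (f x)) has_derivative (\<lambda>v. L (f' x v))) (at x)"
      by (rule bounded_linear.has_derivative[OF assms(1) f'(1)[OF x]])
    show "(\<lambda>y. L (f' y v)) differentiable (at x)" for v
      using f'(2)[OF x, of v] bounded_linear.has_derivative[OF assms(1)]
      unfolding differentiable_def by blast
  qed
qed

lemma twice_differentiable_on_add:
  assumes "twice_differentiable_on f U" "twice_differentiable_on g U"
  shows "twice_differentiable_on (\<lambda>x. f x + g x) U"
proof -
  obtain f' where f: "\<And>x. x \<in> U \<Longrightarrow> (f has_derivative f' x) (at x)"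
    "\<And>x v. x \<in> U \<Longrightarrow> (\<lambda>y. f' y v) differentiable (at x)"
    using assms(1) by (elim twice_differentiable_onE) blast
  obtain g' where g: "\<And>x. x \<in> U \<Longrightarrow> (g has_derivative g' x) (at x)"
    "\<And>x v. x \<in> U \<Longrightarrow> (\<lambda>y. g' y v) differentiable (at x)"
    using assms(2) by (elim twice_differentiable_onE) blast
  show ?thesis
    by (rule twice_differentiable_onI[where f' = "\<lambda>x v. f' x v + g' x v"])
       (auto intro!: has_derivative_add differentiable_add f g)
qed

lemma twice_differentiable_on_mult:
  fixes f g :: "'a::real_normed_vector \<Rightarrow> 'b::real_normed_algebra"
  assumes "twice_differentiable_on f U" "twice_differentiable_on g U"
  shows "twice_differentiable_on (\<lambda>x. f x * g x) U"
proof -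
  obtain f' where f: "\<And>x. x \<in> U \<Longrightarrow> (f has_derivative f' x) (at x)"
    "\<And>x v. x \<in> U \<Longrightarrow> (\<lambda>y. f' y v) differentiable (at x)"
    using assms(1) by (elim twice_differentiable_onE) blast
  obtain g' where g: "\<And>x. x \<in> U \<Longrightarrow> (g has_derivative g' x) (at x)"
    "\<And>x v. x \<in> U \<Longrightarrow> (\<lambda>y. g' y v) differentiable (at x)"
    using assms(2) by (elim twice_differentiable_onE) blast
  have d: "f differentiable (at x)" "g differentiable (at x)" if "x \<in> U" for x
    using f(1)[OF that] g(1)[OF that] by (auto simp: differentiable_def)
  show ?thesis
    by (rule twice_differentiable_onI[where f' = "\<lambda>x v. f x * g' x v + f' x v * g x"])
       (auto intro!: has_derivative_mult differentiable_add differentiable_mult f g d)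
qed

lemma twice_differentiable_on_real_compose:
  fixes f :: "'a::real_normed_vector \<Rightarrow> real"
  assumes f: "twice_differentiable_on f U"
    and k: "\<And>x. x \<in> U \<Longrightarrow> (k has_real_derivative k' (f x)) (at (f x))"
    and k': "\<And>x. x \<in> U \<Longrightarrow> k' differentiable (at (f x))"
  shows "twice_differentiable_on (\<lambda>x. k (f x)) U"
proof -
  obtain f' where f': "\<And>x. x \<in> U \<Longrightarrow> (f has_derivative f' x) (at x)"
    "\<And>x v. x \<in> U \<Longrightarrow> (\<lambda>y. f' y v) differentiable (at x)"
    using f by (elim twice_differentiable_onE) blast
  show ?thesis
  proof (rule twice_differentiable_onI[where f' = "\<lambda>x v. k' (f x) * f' x v"])
    fix x assume x: "x \<in> U"
    show "((\<lambda>x. k (f x)) has_derivative (\<lambda>v. k' (f x) * f' x v)) (at x)"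
      using has_derivative_compose[OF f'(1)[OF x] k[OF x, unfolded has_field_derivative_def]] .
    have "(\<lambda>y. k' (f y)) differentiable (at x)"
      using differentiable_chain_at[of f x k'] k'[OF x] f'(1)[OF x]
      by (auto simp: o_def differentiable_def)
    then show "(\<lambda>y. k' (f y) * f' y v) differentiable (at x)" for v
      by (intro differentiable_mult f'(2) x)
  qed
qed

lemma twice_differentiable_on_ln:
  fixes f :: "'a::real_normed_vector \<Rightarrow> real"
  assumes "twice_differentiable_on f U" "\<And>x. x \<in> U \<Longrightarrow> f x > 0"
  shows "twice_differentiable_on (\<lambda>x. ln (f x)) U"
  by (rule twice_differentiable_on_real_compose[where k' = "\<lambda>t. inverse t"])
     (use assms in \<open>fastforce intro!: assms(1) derivative_eq_intros simp: differentiable_def divide_inverse\<close>)+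

lemma twice_differentiable_on_sqrt:
  fixes f :: "'a::real_normed_vector \<Rightarrow> real"
  assumes "twice_differentiable_on f U" "\<And>x. x \<in> U \<Longrightarrow> f x > 0"
  shows "twice_differentiable_on (\<lambda>x. sqrt (f x)) U"
proof (rule twice_differentiable_on_real_compose[where k = sqrt and f = f and k' = "\<lambda>t. inverse (sqrt t) / 2"])
  fix x assume x: "x \<in> U"
  show "(sqrt has_real_derivative inverse (sqrt (f x)) / 2) (at (f x))"
    using assms(2)[OF x] by (rule DERIV_real_sqrt)
  show "(\<lambda>t. inverse (sqrt t) / 2) differentiable (at (f x))"
    using assms(2)[OF x] unfolding differentiable_def
    by (auto intro!: exI derivative_eq_intros)
qed (rule assms(1))

lemma cmod_square_eq: "(cmod z)\<^sup>2 = Re z * Re z + Im z * Im z"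
  unfolding cmod_power2 by (simp add: power2_eq_square)

text \<open>
  The potential in terms of operations that preserve twofold differentiability: the
  modulus enters through its square, and the quotient under the logarithm is split.
\<close>

lemma EH_pot_Chart1_eq:
  fixes w :: "complex \<times> complex"
  defines "a \<equiv> (cmod (fst w))\<^sup>2 * (1 + (cmod (snd w))\<^sup>2)"
  shows "EH_pot Chart1 w = sqrt (a * a + 1) + ln (1 + (cmod (snd w))\<^sup>2) + (- ln (1 + sqrt (a * a + 1)))"
proof -
  obtain w1 w2 where w: "w = (w1, w2)" by (cases w)
  have "cmod w1 ^ 4 * (1 + (cmod w2)\<^sup>2)\<^sup>2 = a * a"
    by (simp add: a_def w power2_eq_square power4_eq_xxxx)
  moreover have "1 + (cmod w2)\<^sup>2 > 0" "1 + sqrt (a * a + 1) > 0"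
    by (auto intro: add_pos_nonneg)
  ultimately show ?thesis by (simp add: w ln_div)
qed

lemma EH_pot_twice_differentiable: "twice_differentiable_on (EH_pot Chart1) U"
proof -
  have lin: "twice_differentiable_on (\<lambda>w::complex \<times> complex. Re (fst w)) U" "twice_differentiable_on (\<lambda>w::complex \<times> complex. Im (fst w)) U"
    "twice_differentiable_on (\<lambda>w::complex \<times> complex. Re (snd w)) U" "twice_differentiable_on (\<lambda>w::complex \<times> complex. Im (snd w)) U"
    by (auto intro!: twice_differentiable_on_bounded_linear bounded_linear_compose[OF bounded_linear_Re]
      bounded_linear_compose[OF bounded_linear_Im] bounded_linear_fst bounded_linear_snd)
  have pos: "1 + (Re z * Re z + Im z * Im z) > 0" "x * x + 1 > 0" "1 + sqrt (x * x + 1) > 0" for z x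
    by (simp_all add: add_pos_nonneg add_nonneg_pos)
  show ?thesis
    unfolding EH_pot_Chart1_eq[abs_def] cmod_square_eq
    by (intro twice_differentiable_on_const twice_differentiable_on_add twice_differentiable_on_mult
      twice_differentiable_on_linear_compose[OF bounded_linear_minus[OF bounded_linear_ident]]
      twice_differentiable_on_ln twice_differentiable_on_sqrt lin pos)
qed

section \<open>Pluriharmonic functions on a slice\<close>

lemma dee_bar_differentiable:
  assumes "twice_differentiable_on f U" "open U" "w \<in> U"
  shows "(\<lambda>y. dee_bar f y v) differentiable (at w)"
  unfolding dee_bar_def divide_inverse
  by (intro differentiable_add differentiable_mult differentiable_const
      twice_differentiable_on_frechet_derivative(2)[OF assms])

lemma frechet_derivative_add_cmult_on:
  fixes f g k :: "'a::real_normed_vector \<Rightarrow> complex"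
  assumes "f differentiable (at w)" "g differentiable (at w)" "open U" "w \<in> U"
    and "\<And>y. y \<in> U \<Longrightarrow> k y = f y + c * g y"
  shows "frechet_derivative k (at w) v = frechet_derivative f (at w) v + c * frechet_derivative g (at w) v"
proof -
  have "((\<lambda>y. f y + c * g y) has_derivative
      (\<lambda>v. frechet_derivative f (at w) v + c * frechet_derivative g (at w) v)) (at w)"
    using assms(1,2) by (intro has_derivative_add has_derivative_mult_right) (simp_all add: frechet_derivative_works)
  then have "(k has_derivative
      (\<lambda>v. frechet_derivative f (at w) v + c * frechet_derivative g (at w) v)) (at w)"
    by (rule has_derivative_transform_within_open[OF _ assms(3,4)]) (simp add: assms(5))
  from fun_cong[OF frechet_derivative_at[OF this], of v] show ?thesis by simp
qed

lemma dee_dee_bar_add_cmult: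
  assumes f: "twice_differentiable_on f U" and g: "twice_differentiable_on g U"
    and U: "open U" and w: "w \<in> U"
  shows "dee_dee_bar (\<lambda>y. f y + c * g y) w a b = dee_dee_bar f w a b + c * dee_dee_bar g w a b"
proof -
  have fd: "frechet_derivative (\<lambda>y. f y + c * g y) (at y) v
      = frechet_derivative f (at y) v + c * frechet_derivative g (at y) v" if "y \<in> U" for y v
    by (rule frechet_derivative_add_cmult_on[OF twice_differentiable_on_frechet_derivative(1)[OF f U that]
        twice_differentiable_on_frechet_derivative(1)[OF g U that] U that]) simp
  have bar: "dee_bar (\<lambda>y. f y + c * g y) y v = dee_bar f y v + c * dee_bar g y v" if "y \<in> U" for y v
    unfolding dee_bar_def fd[OF that] by (simp add: algebra_simps add_divide_distrib)
  have "frechet_derivative (\<lambda>y. dee_bar (\<lambda>y. f y + c * g y) y v) (at w) v'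
      = frechet_derivative (\<lambda>y. dee_bar f y v) (at w) v' + c * frechet_derivative (\<lambda>y. dee_bar g y v) (at w) v'" for v v'
    by (rule frechet_derivative_add_cmult_on[OF dee_bar_differentiable[OF f U w]
        dee_bar_differentiable[OF g U w] U w bar])
  then show ?thesis
    unfolding dee_dee_bar_def dee_def by (simp add: algebra_simps add_divide_distrib diff_divide_distrib)
qed

lemma has_derivative_slice:
  assumes "f differentiable (at (z, 0))"
  shows "((\<lambda>z::complex. f (z, 0::complex)) has_derivative
     (\<lambda>v. Re v *\<^sub>R frechet_derivative f (at (z, 0)) (1, 0) + Im v *\<^sub>R frechet_derivative f (at (z, 0)) (\<i>, 0))) (at z)"
proof -
  let ?D = "frechet_derivative f (at (z, 0))"
  have D: "(f has_derivative ?D) (at (z, 0))" using assms by (simp add: frechet_derivative_works)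
  have "((\<lambda>z::complex. (z, 0::complex)) has_derivative (\<lambda>v. (v, 0))) (at z)"
    by (intro derivative_intros)
  from has_derivative_compose[OF this] D
  have "((\<lambda>z. f (z, 0)) has_derivative (\<lambda>v. ?D (v, 0))) (at z)" by blast
  moreover have "?D (v, 0) = Re v *\<^sub>R ?D (1, 0) + Im v *\<^sub>R ?D (\<i>, 0)" for v
  proof -
    interpret linear ?D using D by (rule has_derivative_linear)
    have "(v, 0) = Re v *\<^sub>R (1, 0) + Im v *\<^sub>R (\<i>, 0 :: complex)" by (simp add: complex_eq_iff)
    then show ?thesis by (simp only: add scaleR)
  qed
  then have "(\<lambda>v. ?D (v, 0)) = (\<lambda>v. Re v *\<^sub>R ?D (1, 0) + Im v *\<^sub>R ?D (\<i>, 0))" ..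
  ultimately show ?thesis by (simp only:)
qed

text \<open>
  On the vectors \<open>e\<close> and \<open>\<i> e\<close> of the first coordinate direction, \<open>\<partial>\<partial>\<close>-bar of \<open>f\<close> is
  \<open>-2 \<i>\<close> times the derivative of \<open>g = \<partial>f / \<partial>\<close>(conjugate of \<open>w\<^sub>1\<close>) with respect to
  \<open>w\<^sub>1\<close>. If it vanishes, \<open>g\<close> is antiholomorphic in \<open>w\<^sub>1\<close>.
\<close>

lemma dee_dee_bar_eq_0_imp_cauchy_riemann:
  assumes f: "twice_differentiable_on f U" and U: "open U" "w \<in> U"
    and zero: "dee_dee_bar f w (1, 0) (\<i>, 0) = 0"
  defines "g \<equiv> \<lambda>y. dee_bar f y (1, 0)"
  shows "frechet_derivative g (at w) (\<i>, 0) = - \<i> * frechet_derivative g (at w) (1, 0)"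
proof -
  have neg: "times_i (\<i>, 0) = (-1, 0)" "times_i (1, 0) = (\<i>, 0)" by (auto simp: times_i_def)
  have lin: "frechet_derivative k (at y) (-1, 0) = - frechet_derivative k (at y) (1, 0)"
    if "k differentiable (at y)" for k :: "complex \<times> complex \<Rightarrow> complex" and y
    using linear_neg[OF linear_frechet_derivative[OF that], of "(1, 0)"] by simp
  have g: "g differentiable (at w)" unfolding g_def by (rule dee_bar_differentiable[OF f U])
  have bar: "dee_bar f y (\<i>, 0) = 0 + - \<i> * g y" if "y \<in> U" for y
    using lin[OF twice_differentiable_on_frechet_derivative(1)[OF f U(1) that]]
    by (simp add: g_def dee_bar_def neg algebra_simps diff_divide_distrib add_divide_distrib)
  have "frechet_derivative (\<lambda>y. dee_bar f y (\<i>, 0)) (at w) v = 0 + - \<i> * frechet_derivative g (at w) v" for v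
    using frechet_derivative_add_cmult_on[OF differentiable_const g U bar, of v] by simp
  then have "- frechet_derivative g (at w) (\<i>, 0) = \<i> * frechet_derivative g (at w) (1, 0)"
    using zero lin[OF g] unfolding dee_dee_bar_def dee_def neg g_def[symmetric]
    by (simp add: algebra_simps diff_divide_distrib add_divide_distrib)
  from arg_cong[OF this, of uminus] show ?thesis by simp
qed

text \<open>
  For real \<open>\<phi>\<close> the conjugate \<open>q\<close> of \<open>g\<close> is \<open>\<partial>\<phi> / \<partial>w\<^sub>1\<close>. It is holomorphic on the slice
  and has a primitive \<open>G\<close> on the disc; since \<open>d \<phi> = 2 Re (q dw\<^sub>1)\<close> there, \<open>\<phi>\<close> and
  \<open>2 Re G\<close> differ by a constant.
\<close>

lemma pluriharmonic_slice_eq_Re_holomorphic: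
  fixes \<phi> :: "complex \<times> complex \<Rightarrow> real"
  defines "f \<equiv> \<lambda>y. complex_of_real (\<phi> y)"
  assumes f: "twice_differentiable_on f U" and U: "open U"
    and slice: "\<And>z. z \<in> ball 0 R \<Longrightarrow> (z, 0) \<in> U"
    and zero: "\<And>w. w \<in> U \<Longrightarrow> dee_dee_bar f w (1, 0) (\<i>, 0) = 0"
  obtains Q where "Q holomorphic_on ball 0 R" "\<And>z. z \<in> ball 0 R \<Longrightarrow> \<phi> (z, 0) = 2 * Re (Q z)"
proof -
  define g where "g y = dee_bar f y (1, 0)" for y
  define q where "q z = cnj (g (z, 0))" for z
  have "(q has_field_derivative cnj (frechet_derivative g (at (z, 0)) (1, 0))) (at z)"
    if z: "z \<in> ball 0 R" for z
  proof -
    define d where "d = frechet_derivative g (at (z, 0)) (1, 0)"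
    have "frechet_derivative g (at (z, 0)) (\<i>, 0) = - \<i> * d"
      using dee_dee_bar_eq_0_imp_cauchy_riemann[OF f U slice[OF z] zero[OF slice[OF z]]]
      unfolding d_def g_def .
    moreover have "g differentiable (at (z, 0))"
      unfolding g_def by (rule dee_bar_differentiable[OF f U slice[OF z]])
    ultimately have "((\<lambda>z. g (z, 0)) has_derivative (\<lambda>v. Re v *\<^sub>R d + Im v *\<^sub>R (- \<i> * d))) (at z)"
      using has_derivative_slice[of g z] by (simp add: d_def)
    then have "(q has_derivative (\<lambda>v. cnj (Re v *\<^sub>R d + Im v *\<^sub>R (- \<i> * d)))) (at z)"
      unfolding q_def by (rule has_derivative_cnj)
    moreover have "cnj (Re v *\<^sub>R d + Im v *\<^sub>R (- \<i> * d)) = cnj d * v" for v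
      by (simp add: complex_eq_iff algebra_simps)
    ultimately show ?thesis by (simp add: has_field_derivative_def d_def)
  qed
  then have q_hol: "q holomorphic_on ball 0 R" unfolding holomorphic_on_open[OF open_ball] by blast
  obtain G where G': "\<And>z. z \<in> ball 0 R \<Longrightarrow> (G has_field_derivative q z) (at z within ball 0 R)"
    using holomorphic_convex_primitive'[OF convex_ball open_ball q_hol] by blast
  have G: "(G has_field_derivative q z) (at z)" if "z \<in> ball 0 R" for z
    using G'[OF that] that by (simp add: at_within_open[of z "ball 0 R"])
  have "((\<lambda>z. \<phi> (z, 0) - 2 * Re (G z)) has_derivative (\<lambda>v. 0)) (at z)" if z: "z \<in> ball 0 R" for z
  proof -
    have diff: "f differentiable (at (z, 0))"
      by (rule twice_differentiable_on_frechet_derivative(1)[OF f U slice[OF z]])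
    define d1 where "d1 = frechet_derivative f (at (z, 0)) (1, 0)"
    define d2 where "d2 = frechet_derivative f (at (z, 0)) (\<i>, 0)"
    have slice_f: "((\<lambda>z. f (z, 0)) has_derivative (\<lambda>v. Re v *\<^sub>R d1 + Im v *\<^sub>R d2)) (at z)"
      using has_derivative_slice[OF diff] by (simp add: d1_def d2_def)
    have "((\<lambda>z. Im (f (z, 0))) has_derivative (\<lambda>v. Im (Re v *\<^sub>R d1 + Im v *\<^sub>R d2))) (at z)"
      by (rule has_derivative_Im[OF slice_f])
    then have "((\<lambda>z::complex. 0::real) has_derivative (\<lambda>v. Im (Re v *\<^sub>R d1 + Im v *\<^sub>R d2))) (at z)"
      by (simp add: f_def)
    then have "(\<lambda>v. Im (Re v *\<^sub>R d1 + Im v *\<^sub>R d2)) = (\<lambda>v::complex. 0)"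
      by (rule has_derivative_unique) simp
    from fun_cong[OF this, of 1] fun_cong[OF this, of \<i>] have im: "Im d1 = 0" "Im d2 = 0" by auto
    have q: "q z = cnj ((d1 + \<i> * d2) / 2)"
      by (simp add: q_def g_def dee_bar_def times_i_def d1_def d2_def)
    have "((\<lambda>z. Re (f (z, 0)) - 2 * Re (G z)) has_derivative
        (\<lambda>v. Re (Re v *\<^sub>R d1 + Im v *\<^sub>R d2) - 2 * Re (q z * v))) (at z)"
      using G[OF z] slice_f unfolding has_field_derivative_def
      by (intro has_derivative_diff has_derivative_mult_right has_derivative_Re)
    moreover have "Re (Re v *\<^sub>R d1 + Im v *\<^sub>R d2) - 2 * Re (q z * v) = 0" for v
      using im by (simp add: q algebra_simps)
    ultimately show ?thesis by (simp add: f_def)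
  qed
  then have "\<exists>c. \<forall>z\<in>ball 0 R. \<phi> (z, 0) - 2 * Re (G z) = c"
    by (rule has_derivative_zero_constant[OF convex_ball has_derivative_at_withinI])
  then obtain c where c: "\<forall>z\<in>ball 0 R. \<phi> (z, 0) - 2 * Re (G z) = c" ..
  show ?thesis
  proof
    show "(\<lambda>z. G z + of_real (c / 2)) holomorphic_on ball 0 R"
    proof (intro holomorphic_intros)
      show "G holomorphic_on ball 0 R" unfolding holomorphic_on_open[OF open_ball] using G by blast
    qed
    show "\<phi> (z, 0) = 2 * Re (G z + of_real (c / 2))" if "z \<in> ball 0 R" for z
      using bspec[OF c that] by simp
  qed
qed

section \<open>Frames of the line bundle\<close>

lemma holomorphic2_on_power:
  assumes "holomorphic2_on f S"
  shows "holomorphic2_on (\<lambda>w. f w ^ m) S"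
  unfolding holomorphic2_on_def
proof
  fix w assume "w \<in> S"
  then obtain a b where f: "(f has_derivative (\<lambda>(u, v). a * u + b * v)) (at w)"
    using assms unfolding holomorphic2_on_def by blast
  have "((\<lambda>w. f w ^ m) has_derivative
      (\<lambda>(u, v). (of_nat m * f w ^ (m - 1) * a) * u + (of_nat m * f w ^ (m - 1) * b) * v)) (at w)"
    using has_derivative_power[OF f, of m] by (simp add: case_prod_unfold algebra_simps)
  then show "\<exists>a b. ((\<lambda>w. f w ^ m) has_derivative (\<lambda>(u, v). a * u + b * v)) (at w)" by blast
qed

lemma holomorphic2_on_transform:
  assumes "holomorphic2_on f S" "open S" "\<And>w. w \<in> S \<Longrightarrow> f w = g w"
  shows "holomorphic2_on g S"
  unfolding holomorphic2_on_def
proof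
  fix w assume w: "w \<in> S"
  then obtain a b where "(f has_derivative (\<lambda>(u, v). a * u + b * v)) (at w)"
    using assms unfolding holomorphic2_on_def by blast
  then have "(g has_derivative (\<lambda>(u, v). a * u + b * v)) (at w)"
    by (rule has_derivative_transform_within_open[OF _ assms(2) w assms(3)])
  then show "\<exists>a b. (g has_derivative (\<lambda>(u, v). a * u + b * v)) (at w)" by blast
qed

lemma holomorphic2_on_slice:
  assumes "holomorphic2_on f S" "open B" "\<And>z. z \<in> B \<Longrightarrow> (z, 0) \<in> S"
  shows "(\<lambda>z. f (z, 0)) holomorphic_on B"
proof -
  have "\<exists>a. ((\<lambda>z. f (z, 0)) has_field_derivative a) (at z)" if z: "z \<in> B" for z
  proof -
    obtain a b where f: "(f has_derivative (\<lambda>(u, v). a * u + b * v)) (at (z, 0))"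
      using assms(1) assms(3)[OF z] unfolding holomorphic2_on_def by blast
    have "((\<lambda>z::complex. (z, 0::complex)) has_derivative (\<lambda>v. (v, 0))) (at z)"
      by (intro derivative_intros)
    from has_derivative_compose[OF this f] show ?thesis
      by (auto simp: has_field_derivative_def)
  qed
  then show ?thesis using assms(2) by (auto simp: holomorphic_on_open)
qed

lemma tensor_power_simps:
  "nbh (tensor_power L m) = nbh L"
  "trans_fun (tensor_power L m) i j x = trans_fun L i j x ^ m"
  by (simp_all add: tensor_power_def)

text \<open>
  The section of the \<open>m\<close>-th power whose coordinate in the \<open>i\<close>-th trivialization is \<open>1\<close>.
\<close>

definition local_frame :: "'i line_bundle \<Rightarrow> nat \<Rightarrow> 'i \<Rightarrow> blowup \<Rightarrow> 'i \<Rightarrow> complex" where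
  "local_frame L m i x k = (if x \<in> nbh L i \<inter> nbh L k then trans_fun L k i x ^ m else 0)"

lemma trivializing_section_local_frame:
  assumes L: "holomorphic_line_bundle L"
  shows "trivializing_section (tensor_power L m) (nbh L i) (local_frame L m i)"
proof -
  have op: "open (nbh L j)" for j using L by (auto simp: holomorphic_line_bundle_def)
  have hol: "bl_holomorphic_on (trans_fun L j k) (nbh L j \<inter> nbh L k)" for j k
    using L by (auto simp: holomorphic_line_bundle_def)
  have cocycle: "trans_fun L j k x * trans_fun L k l x = trans_fun L j l x"
    if "x \<in> nbh L j" "x \<in> nbh L k" "x \<in> nbh L l" for j k l x
    using L that unfolding holomorphic_line_bundle_def by blast
  have one: "trans_fun L j j x = 1" if "x \<in> nbh L j" for j x
    using L that unfolding holomorphic_line_bundle_def by blast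
  have "local_frame L m i x \<in> fibre (tensor_power L m) x" if "x \<in> nbh L i" for x
  proof -
    have "local_frame L m i x j = trans_fun L j k x ^ m * local_frame L m i x k"
      if "x \<in> nbh L j" "x \<in> nbh L k" for j k
      unfolding local_frame_def using that \<open>x \<in> nbh L i\<close> cocycle[of x j k i]
      by (simp flip: power_mult_distrib)
    moreover have "local_frame L m i x j = 0" if "x \<notin> nbh L j" for j
      using that by (simp add: local_frame_def)
    ultimately show ?thesis unfolding fibre_def tensor_power_simps by blast
  qed
  moreover have "bl_holomorphic_on (\<lambda>x. local_frame L m i x k) (nbh L i \<inter> nbh L k)" for k
    unfolding bl_holomorphic_on_def
  proof
    fix c
    have "bl_holomorphic_on (trans_fun L k i) (nbh L i \<inter> nbh L k)"
      using hol[of k i] by (simp add: Int_commute)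
    then have "holomorphic2_on (trans_fun L k i \<circ> param c) (param c -` (nbh L i \<inter> nbh L k))"
      unfolding bl_holomorphic_on_def by blast
    from holomorphic2_on_power[OF this, of m] show "holomorphic2_on ((\<lambda>x. local_frame L m i x k) \<circ> param c) (param c -` (nbh L i \<inter> nbh L k))"
    proof (rule holomorphic2_on_transform)
      show "open (param c -` (nbh L i \<inter> nbh L k))"
        using open_Int[OF op[of i] op[of k]] unfolding open_blowup_def by blast
    qed (auto simp: local_frame_def)
  qed
  moreover have "local_frame L m i x \<noteq> (\<lambda>k. 0)" if "x \<in> nbh L i" for x
  proof
    assume "local_frame L m i x = (\<lambda>k. 0)"
    from fun_cong[OF this, of i] show False using that one[of x i] by (simp add: local_frame_def)
  qed
  ultimately show ?thesis
    unfolding trivializing_section_def holomorphic_section_def tensor_power_simps by blast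
qed

lemma fibre_eq_multiple_of_local_frame:
  assumes "v \<in> fibre (tensor_power L m) x" "x \<in> nbh L i"
  shows "v = (\<lambda>k. v i * local_frame L m i x k)"
proof
  fix k
  have "v k = trans_fun L k i x ^ m * v i" if "x \<in> nbh L k"
    using assms that unfolding fibre_def tensor_power_simps by blast
  moreover have "v k = 0" if "x \<notin> nbh L k"
    using assms that unfolding fibre_def tensor_power_simps by blast
  ultimately show "v k = v i * local_frame L m i x k"
    using assms(2) unfolding local_frame_def by (cases "x \<in> nbh L k") simp_all
qed

lemma hermitian_metric_cmult:
  assumes h: "hermitian_metric E h" and v: "v \<in> fibre E x"
  shows "h x (\<lambda>k. c * v k) (\<lambda>k. c * v k) = of_real ((cmod c)\<^sup>2) * h x v v"
proof -
  have lin: "h x (\<lambda>i. u i + c * v i) w = h x u w + c * h x v w"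
    if "u \<in> fibre E x" "v \<in> fibre E x" "w \<in> fibre E x" for u v w c
    by (rule h[unfolded hermitian_metric_def, THEN conjunct1, rule_format, OF that])
  have conj: "h x w u = cnj (h x u w)" if "u \<in> fibre E x" "w \<in> fibre E x" for u w
    by (rule h[unfolded hermitian_metric_def, THEN conjunct2, THEN conjunct1, rule_format, OF that])
  have zero: "(\<lambda>k. 0) \<in> fibre E x" by (simp add: fibre_def)
  have cv: "(\<lambda>k. c * v k) \<in> fibre E x"
    unfolding fibre_def
  proof (intro CollectI conjI allI impI)
    have "v i = 0" if "x \<notin> nbh E i" for i
      using v that unfolding fibre_def by blast
    then show "c * v i = 0" if "x \<notin> nbh E i" for i
      using that by simp
    fix i j assume "x \<in> nbh E i \<inter> nbh E j"
    then have "v i = trans_fun E i j x * v j" using v unfolding fibre_def by blast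
    from arg_cong[OF this, of "(*) c"] show "c * v i = trans_fun E i j x * (c * v j)"
      by (simp only: mult.left_commute)
  qed
  have "h x (\<lambda>k. 0) w = 0" if "w \<in> fibre E x" for w
    using lin[OF zero zero that, of 1] by simp
  then have scale: "h x (\<lambda>k. c * v k) w = c * h x v w" if "w \<in> fibre E x" for w
    using lin[OF zero v that, of c] that by simp
  have "h x (\<lambda>k. c * v k) (\<lambda>k. c * v k) = c * cnj (h x (\<lambda>k. c * v k) v)"
    using scale[OF cv] conj[OF cv v] by simp
  also have "\<dots> = c * cnj c * h x v v"
    using scale[OF v] conj[OF v v] by simp
  finally show ?thesis by (simp only: complex_norm_square)
qed

section \<open>The balanced condition on the slice\<close>

lemma EH_pot_slice:
  "complex_of_real (exp (real m * EH_pot Chart1 (z, 0))) = EH_series m (of_real ((cmod z)\<^sup>2))"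
proof -
  define S where "S = sqrt (cmod z ^ 4 + 1)"
  have S: "1 + S > 0" by (auto simp: S_def intro: add_pos_nonneg)
  have "1 + (complex_of_real ((cmod z)\<^sup>2))\<^sup>2 = of_real (cmod z ^ 4 + 1)" by simp
  moreover have "csqrt (of_real (cmod z ^ 4 + 1)) = of_real S"
    by (subst csqrt_of_real_nonneg) (auto simp: S_def add.commute)
  ultimately have root: "csqrt (1 + (complex_of_real ((cmod z)\<^sup>2))\<^sup>2) = of_real S" by (simp only:)
  have EH: "EH_pot Chart1 (z, 0) = S - ln (1 + S)"
    using S by (simp add: S_def ln_div)
  have "exp (real m * EH_pot Chart1 (z, 0)) = exp (real m * S) / (1 + S) ^ m"
    unfolding EH using S by (simp add: right_diff_distrib exp_diff exp_of_nat_mult)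
  also have "of_real \<dots> = EH_series m (of_real ((cmod z)\<^sup>2))"
    unfolding EH_series_def root by (simp flip: exp_of_real)
  finally show ?thesis .
qed

text \<open>
  The balanced condition on the slice, reduced to one complex variable: \<open>\<rho>\<close> is the squared
  length of a frame and \<open>f j\<close> are the coefficients of the sections. Absorbing \<open>exp Q\<close> into the
  \<open>f j\<close>, that is, passing to a frame whose squared length is exactly \<open>exp\<close> of minus the
  potential, gives a sum of squares equal to the radial function \<open>EH_series m\<close>.
\<close>

lemma EH_weight_not_inverse_sum_of_squares:
  fixes f :: "nat \<Rightarrow> complex \<Rightarrow> complex"
  assumes f: "\<And>j. f j holomorphic_on ball 0 R" and R: "R > 0" and m: "m > 0" and c: "c > 0"
    and sum: "\<And>z. z \<in> ball 0 R \<Longrightarrow> (\<lambda>j. (cmod (f j z))\<^sup>2 * \<rho> z) sums c"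
    and Q: "Q holomorphic_on ball 0 R"
    and \<rho>: "\<And>z. z \<in> ball 0 R \<Longrightarrow> \<rho> z = exp (2 * Re (Q z) - real m * EH_pot Chart1 (z, 0))"
  shows False
proof -
  define F where "F j z = f j z * exp (Q z) / of_real (sqrt c)" for j z
  have "(deriv ^^ n) (EH_series m) 0 \<in> \<real>\<^sub>\<ge>\<^sub>0" for n
  proof (rule sum_of_squares_radial_nonneg[of F R _ 1])
    show "F j holomorphic_on ball 0 R" for j
      unfolding F_def using f Q c by (auto intro!: holomorphic_intros)
    show "EH_series m holomorphic_on ball 0 1"
      using slit_avoids_unit_disc by (intro EH_series_holomorphic) auto
    show "(\<lambda>j. of_real ((cmod (F j z))\<^sup>2)) sums EH_series m (of_real ((cmod z)\<^sup>2))"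
      if z: "z \<in> ball 0 R" for z
    proof -
      let ?e = "exp (real m * EH_pot Chart1 (z, 0))"
      have "(cmod (F j z))\<^sup>2 = (cmod (f j z))\<^sup>2 * \<rho> z * (?e / c)" for j
      proof -
        have "exp (Re (Q z)) * exp (Re (Q z)) = \<rho> z * ?e"
          by (simp add: \<rho>[OF z] flip: exp_add)
        then show ?thesis
          using c by (simp add: F_def norm_mult norm_divide power_mult_distrib power_divide power2_eq_square)
      qed
      moreover have "(\<lambda>j. (cmod (f j z))\<^sup>2 * \<rho> z * (?e / c)) sums (c * (?e / c))"
        by (rule sums_mult2[OF sum[OF z]])
      ultimately have "(\<lambda>j. (cmod (F j z))\<^sup>2) sums ?e" using c by simp
      then have "(\<lambda>j. complex_of_real ((cmod (F j z))\<^sup>2)) sums of_real ?e" by (rule sums_of_real)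
      then show ?thesis by (simp only: EH_pot_slice)
    qed
  qed (use R in auto)
  with EH_series_has_negative_coefficient[OF m] show False by blast
qed

text \<open>
  Both \<open>-ln h(\<sigma>, \<sigma>)\<close> and \<open>m\<close> times the given potential are potentials of \<open>m \<omega>\<close> on
  the domain of the frame, so \<open>\<partial>\<partial>\<close>-bar annihilates their difference.
\<close>

lemma has_Ric_imp_pluriharmonic:
  fixes L :: "'i line_bundle"
  assumes L: "holomorphic_line_bundle L" and h: "hermitian_metric (tensor_power L m) h"
    and Ric: "has_Ric (tensor_power L m) h (\<lambda>k w a b. of_nat m * omega_EH k w a b)"
  defines "U \<equiv> \<lambda>i. param Chart1 -` nbh L i"
    and "\<phi> \<equiv> \<lambda>i y. ln (Re (h (param Chart1 y) (local_frame L m i (param Chart1 y)) (local_frame L m i (param Chart1 y))))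
        + real m * EH_pot Chart1 y"
  shows "twice_differentiable_on (\<lambda>y. complex_of_real (\<phi> i y)) (U i)" (is ?th1)
    and "w \<in> U i \<Longrightarrow> dee_dee_bar (\<lambda>y. complex_of_real (\<phi> i y)) w a b = 0" (is "_ \<Longrightarrow> ?th2")
    and "y \<in> U i \<Longrightarrow> Re (h (param Chart1 y) (local_frame L m i (param Chart1 y)) (local_frame L m i (param Chart1 y))) > 0"
       (is "_ \<Longrightarrow> ?th3 y")
    and "open (U i)"
proof -
  let ?E = "tensor_power L m" and ?\<sigma> = "local_frame L m i"
  define H where "H y = h (param Chart1 y) (?\<sigma> (param Chart1 y)) (?\<sigma> (param Chart1 y))" for y
  have triv: "trivializing_section ?E (nbh L i) ?\<sigma>"
    using L by (rule trivializing_section_local_frame)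
  have V: "open (nbh L i)" using L by (auto simp: holomorphic_line_bundle_def)
  then show U: "open (U i)" unfolding U_def open_blowup_def by blast
  show pos: "?th3 y" if "y \<in> U i" for y
  proof -
    have "?\<sigma> (param Chart1 y) \<in> fibre ?E (param Chart1 y)" "?\<sigma> (param Chart1 y) \<noteq> (\<lambda>i. 0)"
      using triv that unfolding trivializing_section_def holomorphic_section_def U_def by blast+
    then show ?thesis
      by (rule h[unfolded hermitian_metric_def, THEN conjunct2, THEN conjunct2, THEN conjunct1, rule_format])
  qed
  have "bl_smooth_on (\<lambda>x. h x (?\<sigma> x) (?\<sigma> x)) (nbh L i)"
    using V triv unfolding trivializing_section_def
    by (intro h[unfolded hermitian_metric_def, THEN conjunct2, THEN conjunct2, THEN conjunct2, rule_format]) blast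
  then have "smooth_on H (U i)"
    unfolding bl_smooth_on_def H_def U_def o_def by blast
  then have "twice_differentiable_on H (U i)"
    unfolding smooth_on_def by (blast intro: Ck_on_2_imp_twice_differentiable_on)
  then have "twice_differentiable_on (\<lambda>y. ln (Re (H y))) (U i)"
    by (intro twice_differentiable_on_ln twice_differentiable_on_linear_compose[OF bounded_linear_Re] pos[folded H_def])
  then have tw1: "twice_differentiable_on (\<lambda>y. complex_of_real (ln (Re (H y)))) (U i)"
    by (rule twice_differentiable_on_linear_compose[OF bounded_linear_of_real])
  have tw2: "twice_differentiable_on (\<lambda>y. complex_of_real (EH_pot Chart1 y)) (U i)"
    by (rule twice_differentiable_on_linear_compose[OF bounded_linear_of_real EH_pot_twice_differentiable])
  have \<phi>: "(\<lambda>y. complex_of_real (\<phi> i y))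
      = (\<lambda>y. complex_of_real (ln (Re (H y))) + of_nat m * complex_of_real (EH_pot Chart1 y))"
    by (simp add: \<phi>_def H_def)
  show ?th1 unfolding \<phi> by (intro twice_differentiable_on_add twice_differentiable_on_mult
      twice_differentiable_on_const tw1 tw2)
  show ?th2 if w: "w \<in> U i"
  proof -
    have "of_nat m * omega_EH Chart1 w a b
        = - (\<i> / (2 * of_real pi)) * dee_dee_bar (\<lambda>y. complex_of_real (ln (Re (H y)))) w a b"
      using Ric V triv w unfolding has_Ric_def H_def U_def by blast
    then have "\<i> / (2 * of_real pi) * (dee_dee_bar (\<lambda>y. complex_of_real (ln (Re (H y)))) w a b
        + of_nat m * dee_dee_bar (\<lambda>y. complex_of_real (EH_pot Chart1 y)) w a b) = 0"
      unfolding omega_EH_def by (simp add: algebra_simps)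
    then show ?thesis
      unfolding \<phi> dee_dee_bar_add_cmult[OF tw1 tw2 U w] by simp
  qed
qed

text \<open>
  The infinite sum defining \<open>\<epsilon>\<close> has the value \<open>0\<close> by convention where it diverges, so a
  positive value implies convergence. Indices beyond the dimension are filled up with zeros to
  obtain an ordinary series.
\<close>

lemma balanced_sum_in_frame:
  assumes h: "hermitian_metric (tensor_power L m) h" and x: "x \<in> nbh L i"
    and s: "\<And>j. enat j < N \<Longrightarrow> holomorphic_section (tensor_power L m) UNIV (s j)"
    and eps: "epsilon_fun h N s x = c" and c: "c > 0"
    and frame: "local_frame L m i x \<in> fibre (tensor_power L m) x"
  shows "(\<lambda>j. (cmod (if enat j < N then s j x i else 0))\<^sup>2
      * Re (h x (local_frame L m i x) (local_frame L m i x))) sums c"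
proof -
  let ?J = "{j. enat j < N}" and ?\<sigma> = "local_frame L m i x"
  have "((\<lambda>j. Re (h x (s j x) (s j x))) has_sum c) ?J"
  proof -
    have "(\<lambda>j. Re (h x (s j x) (s j x))) summable_on ?J"
      using eps c infsum_not_exists unfolding epsilon_fun_def by fastforce
    from has_sum_infsum[OF this] show ?thesis using eps unfolding epsilon_fun_def by simp
  qed
  moreover have "Re (h x (s j x) (s j x)) = (cmod (s j x i))\<^sup>2 * Re (h x ?\<sigma> ?\<sigma>)" if "j \<in> ?J" for j
  proof -
    have "s j x \<in> fibre (tensor_power L m) x"
      using s[of j] that by (auto simp: holomorphic_section_def)
    then have "s j x = (\<lambda>k. s j x i * ?\<sigma> k)"
      using x by (rule fibre_eq_multiple_of_local_frame)
    then have "h x (s j x) (s j x) = of_real ((cmod (s j x i))\<^sup>2) * h x ?\<sigma> ?\<sigma>"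
      using hermitian_metric_cmult[OF h frame, of "s j x i"] by simp
    then show ?thesis by (simp del: of_real_power)
  qed
  ultimately have "((\<lambda>j. (cmod (if enat j < N then s j x i else 0))\<^sup>2 * Re (h x ?\<sigma> ?\<sigma>)) has_sum c) UNIV"
    by (subst has_sum_cong_neutral[where T = ?J and g = "\<lambda>j. Re (h x (s j x) (s j x))"]) auto
  then show ?thesis by (rule has_sum_imp_sums)
qed

theorem theorem1p1:
  fixes L :: "'i line_bundle" and m :: nat
  assumes "holomorphic_line_bundle L"
    and "c1 L = dR_class omega_EH"
    and "m > 0"
  shows "\<not> EH_balanced L m"
proof
  note L = assms(1)
  assume "EH_balanced L m"
  then obtain h N s c where h: "hermitian_metric (tensor_power L m) h"
    and Ric: "has_Ric (tensor_power L m) h (\<lambda>k w a b. of_nat m * omega_EH k w a b)"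
    and basis: "orthonormal_basis (tensor_power L m) h N s"
    and c: "c > 0" and eps: "\<And>x. epsilon_fun h N s x = c"
    unfolding EH_balanced_def by blast
  have s: "holomorphic_section (tensor_power L m) UNIV (s j)" if "enat j < N" for j
    using basis that unfolding orthonormal_basis_def H_space_def by blast
  obtain i where i: "param Chart1 (0, 0) \<in> nbh L i"
    using L unfolding holomorphic_line_bundle_def by blast
  define U where "U = param Chart1 -` nbh L i"
  define \<rho> where "\<rho> y = Re (h (param Chart1 y) (local_frame L m i (param Chart1 y)) (local_frame L m i (param Chart1 y)))" for y
  note pluri = has_Ric_imp_pluriharmonic[OF L h Ric, where i = i, folded U_def \<rho>_def]
  obtain R where R: "R > 0" "ball (0, 0) R \<subseteq> U"
    using pluri(4) i unfolding open_contains_ball U_def by blast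
  have slice: "(z, 0) \<in> U" if "z \<in> ball 0 R" for z
    using R(2) that by (auto simp: subset_iff dist_Pair_Pair)
  obtain Q where Q: "Q holomorphic_on ball 0 R"
    "\<And>z. z \<in> ball 0 R \<Longrightarrow> ln (\<rho> (z, 0)) + real m * EH_pot Chart1 (z, 0) = 2 * Re (Q z)"
    using pluriharmonic_slice_eq_Re_holomorphic[OF pluri(1) pluri(4) slice pluri(2)] by blast
  define f where "f j z = (if enat j < N then s j (param Chart1 (z, 0)) i else 0)" for j z
  show False
  proof (rule EH_weight_not_inverse_sum_of_squares[OF _ R(1) assms(3) c _ Q(1)])
    show "f j holomorphic_on ball 0 R" for j
    proof (cases "enat j < N")
      case True
      have "bl_holomorphic_on (\<lambda>x. s j x i) (UNIV \<inter> nbh L i)"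
        using s[OF True] by (simp add: holomorphic_section_def tensor_power_def)
      then have "holomorphic2_on (\<lambda>w. s j (param Chart1 w) i) U"
        unfolding bl_holomorphic_on_def o_def U_def by (metis Int_UNIV_left)
      from holomorphic2_on_slice[OF this open_ball[of 0 R] slice] show ?thesis
        using True unfolding f_def[abs_def] by simp
    qed (simp add: f_def[abs_def])
    show "(\<lambda>j. (cmod (f j z))\<^sup>2 * \<rho> (z, 0)) sums c" if z: "z \<in> ball 0 R" for z
    proof -
      have x: "param Chart1 (z, 0) \<in> nbh L i" using slice[OF z] by (simp add: U_def)
      then have "local_frame L m i (param Chart1 (z, 0)) \<in> fibre (tensor_power L m) (param Chart1 (z, 0))"
        using trivializing_section_local_frame[OF L, of m i]
        unfolding trivializing_section_def holomorphic_section_def by blast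
      from balanced_sum_in_frame[OF h x s eps c this] show ?thesis
        by (simp only: f_def \<rho>_def)
    qed
    show "\<rho> (z, 0) = exp (2 * Re (Q z) - real m * EH_pot Chart1 (z, 0))" if "z \<in> ball 0 R" for z
      using Q(2)[OF that] pluri(3)[OF slice[OF that]] by (simp flip: Q(2)[OF that])
  qed
qed

end
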